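(* Let $M$ be an $m\times n$ ACI-matrix over a field $\mathbb{F}$ with $|\mathbb{F}|\geq\max\{m,n+1\}$. Then $M$ is constantRank if and only if there exist a nonsingular constant matrix $R$ and a permutation matrix $Q$ such that $$RMQ=\begin{bmatrix} \mathbf{W} & * & *\\ 0 & \mathbf{S} & *\\ 0 & 0 & \mathbf{T}\end{bmatrix}$$ where: $\mathbf{W}=\begin{bmatrix} U_1 & *\end{bmatrix}$ is wide with $U_1$ a square upper unitriangular block (ones on the diagonal, zeros below it, arbitrary entries above it), or $\mathbf{W}$ is wide degenerate or void; $\mathbf{S}$ is a square upper unitriangular block or void; and $\mathbf{T}=\begin{bmatrix} * \\ U_3\end{bmatrix}$ is tall with $U_3$ a square upper unitriangular block, or $\mathbf{T}$ is tall degenerate or void (here $*$ denotes arbitrary blocks of appropriate sizes with ACI entries). Moreover, if $\mathbf{S}$ is required to be as large as possible, then the three blocks $\mathbf{W}$, $\mathbf{S}$, $\mathbf{T}$ are unique up to equivalence.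
   Context: An ACI-matrix over a field $\mathbb{F}$ is a matrix with entries in $\mathbb{F}[x_1,\dots,x_k]$ whose entries are polynomials of degree at most one and such that no indeterminate appears in two different columns. A completion is an assignment of values in $\mathbb{F}$ to all indeterminates, producing a constant matrix; $\mathrm{maxRank}(M)$ and $\mathrm{minRank}(M)$ are the maximum and minimum ranks of completions, and $M$ is constantRank if $\mathrm{maxRank}(M)=\mathrm{minRank}(M)$. Two ACI-matrices are equivalent, $N\sim N'$, if $N'=RNQ$ with $R$ nonsingular constant and $Q$ a permutation matrix. Wide/tall/square: more columns than rows / more rows than columns / equal. ACI-matrices of size $0\times q$ ($q>0$, wide degenerate), $p\times 0$ ($p>0$, tall degenerate) and $0\times 0$ (void) are allowed as blocks. *)

theory Defs
  imports "Jordan_Normal_Form.DL_Rank" "HOL-Combinatorics.Permutations"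
begin

text \<open>An ACI-matrix is represented by its constant part and, for every indeterminate
  x_v (v a natural number), the constant matrix of coefficients of x_v.  Entry (i,j)
  of the ACI-matrix is the degree-at-most-one polynomial
  aci_const M (i,j) + sum over v of (aci_lin M v)(i,j) * x_v.
  Only finitely many indeterminates may occur.\<close>

record 'a aci =
  aci_const :: "'a mat"
  aci_lin :: "nat \<Rightarrow> 'a mat"

definition aci_mat :: "'a::field aci \<Rightarrow> nat \<Rightarrow> nat \<Rightarrow> bool" where
  "aci_mat M m n \<longleftrightarrow>
     aci_const M \<in> carrier_mat m n \<and>
     (\<forall>v. aci_lin M v \<in> carrier_mat m n) \<and>
     (\<exists>k. \<forall>v\<ge>k. aci_lin M v = 0\<^sub>m m n) \<and>
     (\<forall>v i j i' j'. i < m \<longrightarrow> i' < m \<longrightarrow> j < n \<longrightarrow> j' < n \<longrightarrow>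
        aci_lin M v $$ (i,j) \<noteq> 0 \<longrightarrow> aci_lin M v $$ (i',j') \<noteq> 0 \<longrightarrow> j = j')"

definition aci_vars :: "'a::field aci \<Rightarrow> nat set" where
  "aci_vars M = {v. aci_lin M v \<noteq> 0\<^sub>m (dim_row (aci_const M)) (dim_col (aci_const M))}"

definition completion :: "'a::field aci \<Rightarrow> (nat \<Rightarrow> 'a) \<Rightarrow> 'a mat" where
  "completion M a = mat (dim_row (aci_const M)) (dim_col (aci_const M))
     (\<lambda>(i,j). aci_const M $$ (i,j) + (\<Sum>v\<in>aci_vars M. a v * aci_lin M v $$ (i,j)))"

definition mat_rank :: "'a::field mat \<Rightarrow> nat" where
  "mat_rank A = vec_space.rank (dim_row A) A"

definition maxRank :: "'a::field aci \<Rightarrow> nat" where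
  "maxRank M = Max {mat_rank (completion M a) | a. True}"

definition minRank :: "'a::field aci \<Rightarrow> nat" where
  "minRank M = Min {mat_rank (completion M a) | a. True}"

definition constantRank :: "'a::field aci \<Rightarrow> bool" where
  "constantRank M \<longleftrightarrow> maxRank M = minRank M"

definition aci_mult :: "'a::field mat \<Rightarrow> 'a aci \<Rightarrow> 'a mat \<Rightarrow> 'a aci" where
  "aci_mult R M Q = \<lparr> aci_const = R * aci_const M * Q, aci_lin = (\<lambda>v. R * aci_lin M v * Q) \<rparr>"

definition permutation_mat :: "nat \<Rightarrow> 'a::field mat \<Rightarrow> bool" where
  "permutation_mat n Q \<longleftrightarrow>
     (\<exists>p. p permutes {..<n} \<and> Q = mat n n (\<lambda>(i,j). if i = p j then 1 else 0))"

definition aci_equiv :: "'a::field aci \<Rightarrow> 'a aci \<Rightarrow> bool" where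
  "aci_equiv N N' \<longleftrightarrow>
     (\<exists>R Q. R \<in> carrier_mat (dim_row (aci_const N)) (dim_row (aci_const N)) \<and>
            invertible_mat R \<and> permutation_mat (dim_col (aci_const N)) Q \<and>
            N' = aci_mult R N Q)"

definition aci_block :: "'a::field aci \<Rightarrow> nat \<Rightarrow> nat \<Rightarrow> nat \<Rightarrow> nat \<Rightarrow> 'a aci" where
  "aci_block M r0 r c0 c =
     \<lparr> aci_const = mat r c (\<lambda>(i,j). aci_const M $$ (r0+i, c0+j)),
       aci_lin = (\<lambda>v. mat r c (\<lambda>(i,j). aci_lin M v $$ (r0+i, c0+j))) \<rparr>"

definition aci_entry_const :: "'a::field aci \<Rightarrow> nat \<Rightarrow> nat \<Rightarrow> 'a \<Rightarrow> bool" where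
  "aci_entry_const M i j c \<longleftrightarrow> aci_const M $$ (i,j) = c \<and> (\<forall>v. aci_lin M v $$ (i,j) = 0)"

definition upper_unitri_at :: "'a::field aci \<Rightarrow> nat \<Rightarrow> nat \<Rightarrow> nat \<Rightarrow> bool" where
  "upper_unitri_at M r0 c0 s \<longleftrightarrow>
     (\<forall>i<s. aci_entry_const M (r0+i) (c0+i) 1) \<and>
     (\<forall>i<s. \<forall>j<s. j < i \<longrightarrow> aci_entry_const M (r0+i) (c0+j) 0)"

text \<open>N (an m x n ACI-matrix) has the block form [W * *; 0 S *; 0 0 T] where
  W is r1 x c1, S is s x s, T is r3 x c3, with the conditions of the theorem.\<close>
definition block_form :: "'a::field aci \<Rightarrow> nat \<Rightarrow> nat \<Rightarrow> nat \<Rightarrow> nat \<Rightarrow> nat \<Rightarrow> nat \<Rightarrow> nat \<Rightarrow> bool" where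
  "block_form N m n r1 c1 s r3 c3 \<longleftrightarrow>
     r1 + s + r3 = m \<and> c1 + s + c3 = n \<and>
     \<comment> \<open>zero blocks below the block diagonal\<close>
     (\<forall>i<m. \<forall>j<n. ((r1 \<le> i \<and> j < c1) \<or> (r1 + s \<le> i \<and> j < c1 + s))
        \<longrightarrow> aci_entry_const N i j 0) \<and>
     \<comment> \<open>W = [U1 *] wide with U1 upper unitriangular, or W wide degenerate or void\<close>
     (r1 = 0 \<or> (r1 < c1 \<and> upper_unitri_at N 0 0 r1)) \<and>
     \<comment> \<open>S upper unitriangular or void\<close>
     upper_unitri_at N r1 c1 s \<and>
     \<comment> \<open>T = [*; U3] tall with U3 upper unitriangular, or T tall degenerate or void\<close>
     (c3 = 0 \<or> (c3 < r3 \<and> upper_unitri_at N (r1 + s + (r3 - c3)) (c1 + s) c3))"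

definition normal_form :: "'a::field aci \<Rightarrow> nat \<Rightarrow> nat \<Rightarrow> 'a mat \<Rightarrow> 'a mat \<Rightarrow> nat \<Rightarrow> nat \<Rightarrow> nat \<Rightarrow> nat \<Rightarrow> nat \<Rightarrow> bool" where
  "normal_form M m n R Q r1 c1 s r3 c3 \<longleftrightarrow>
     R \<in> carrier_mat m m \<and> invertible_mat R \<and> permutation_mat n Q \<and>
     block_form (aci_mult R M Q) m n r1 c1 s r3 c3"

end

theory Submission
  imports Defs "HOL-Library.Function_Algebras"
begin

text \<open>
  The completions of column \<open>j\<close> form a flat \<open>A j\<close>, and since no indeterminate occurs in two columns,
  the completions of the matrix are exactly the transversals of the family \<open>A\<close>. The function
  \<open>V \<mapsto> dim V + card {j. \<not> A j \<subseteq> V}\<close> on subspaces is submodular, bounds the rank of every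
  transversal, and its minimum is attained as a rank (Rado). So if the rank is constant, then for
  every minimizer \<open>V\<close> the columns inside \<open>V\<close> always span \<open>V\<close> and the remaining columns are always
  independent modulo \<open>V\<close>. The least and the greatest minimizer cut out the blocks \<open>W\<close>, \<open>S\<close>, \<open>T\<close>;
  over a large field, where a flat is not a union of few proper subflats, these independence and
  spanning properties allow the columns to be peeled off one at a time, giving unit pivots.
  Conversely, the flag of any normal form consists of minimizers, and \<open>S\<close> of maximal size forces
  them to be the extreme ones; two such normal forms then differ by a block triangular row
  transformation.
\<close>

section \<open>Subspaces and the rank formula for affine families\<close>

text \<open>The obstacle is uniformity. Constant rank says something about each completion
  separately, while a normal form asks for one basis and one column order that produce unit pivots
  for all completions at once. The exchange of quantifiers is a covering argument: for each point
  some column index works, the points served by one index lie in a subspace, and a flat covered by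
  fewer than |F| subspaces lies in one of them. In the independent part one column is held fixed and
  at most n - 1 indices remain, so |F| >= n is enough there; in the spanning part every column may
  contribute a subspace, so |F| > n is asked, which is the origin of n + 1. Taking the extreme
  minimizers also gives the strict shapes. The zero space is a minimizer only if W has no rows, and
  the full space only if T is void; in all other cases the strict inequality between bounds makes W
  strictly wide and T strictly tall.\<close>

locale finite_dim_subspace = vector_space scale
  for scale :: "'a::field \<Rightarrow> 'b::ab_group_add \<Rightarrow> 'b" (infixr \<open>*s\<close> 75) +
  fixes E :: "'b set"
  assumes subspace_E: "subspace E"
    and fin_span_E: "\<exists>B. finite B \<and> E \<subseteq> span B"
begin

section \<open>Dimension inequalities inside \<open>E\<close>\<close>

lemma span_subset_E: "X \<subseteq> E \<Longrightarrow> span X \<subseteq> E"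
  by (rule span_minimal[OF _ subspace_E])

lemma finite_indep: "independent X \<Longrightarrow> X \<subseteq> E \<Longrightarrow> finite X"
  using fin_span_E independent_span_bound by (meson subset_trans)

text \<open>An infinite basis has cardinality 0, so \<open>dim\<close> is not monotone in the
  ambient space; the inclusion of \<open>T\<close> in \<open>E\<close> supplies a finite
  basis.\<close>

lemma dim_le_of_subset_span:
  assumes "S \<subseteq> span T" "T \<subseteq> E"
  shows "dim S \<le> dim T"
proof -
  obtain C where C: "C \<subseteq> T" "independent C" "T \<subseteq> span C" "card C = dim T"
    by (rule basis_exists)
  have "finite C" using C assms finite_indep by blast
  moreover have "S \<subseteq> span C"
    using assms(1) C(3) span_minimal[OF C(3) subspace_span] by blast
  ultimately show ?thesis using dim_le_card C(4) by metis
qed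

lemma dim_insert_notin:
  assumes "x \<notin> span S" "S \<subseteq> E" "x \<in> E"
  shows "dim (insert x S) = Suc (dim S)"
proof -
  obtain C where C: "C \<subseteq> S" "independent C" "S \<subseteq> span C" "card C = dim S"
    by (rule basis_exists)
  have fin: "finite C" using C assms finite_indep by blast
  have x: "x \<notin> span C" using assms(1) C(1) span_mono by blast
  have "independent (insert x C)" using independent_insertI[OF x C(2)] .
  moreover have "insert x S \<subseteq> span (insert x C)"
    using C(3) span_mono[of C "insert x C"] span_base by blast
  moreover have "card (insert x C) = Suc (dim S)"
    using fin x C(4) span_base by (metis card_insert_disjoint)
  ultimately show ?thesis using C(1) by (intro dim_unique[of "insert x C"]) auto
qed

lemma dim_insert_le:
  assumes "S \<subseteq> E" "x \<in> E"
  shows "dim (insert x S) \<le> Suc (dim S)"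
proof (cases "x \<in> span S")
  case True
  then show ?thesis using span_redundant[of x S] by (metis dim_span le_Suc_eq order_refl)
qed (simp add: dim_insert_notin assms)

lemma dim_Un_le:
  assumes "finite Y" "S \<subseteq> E" "Y \<subseteq> E"
  shows "dim (S \<union> Y) \<le> dim S + card Y"
  using assms(1,3)
proof (induction Y rule: finite_induct)
  case (insert y Y)
  have "dim (insert y (S \<union> Y)) \<le> Suc (dim (S \<union> Y))"
    using insert assms by (intro dim_insert_le) auto
  then show ?case using insert by simp
qed simp

lemma subspace_eq_of_dim_le:
  assumes "subspace S" "S \<subseteq> T" "T \<subseteq> E" "dim T \<le> dim S"
  shows "S = T"
proof (rule ccontr)
  assume "S \<noteq> T"
  then obtain x where x: "x \<in> T" "x \<notin> S" using assms(2) by blast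
  have "x \<notin> span S" using x(2) assms(1) by (metis span_eq_iff)
  then have "dim (insert x S) = Suc (dim S)"
    using assms x by (intro dim_insert_notin) auto
  moreover have "dim (insert x S) \<le> dim T"
    using x assms span_superset by (intro dim_le_of_subset_span) auto
  ultimately show False using assms(4) by simp
qed

text \<open>A basis of the intersection, extended to one of \<open>S\<close>, gains
  \<open>dim S - dim (S \<inter> T)\<close> vectors, and these together with \<open>T\<close> span
  the sum.\<close>

lemma dim_sum_Int_le:
  assumes "subspace S" "subspace T" "S \<subseteq> E" "T \<subseteq> E"
  shows "dim (span (S \<union> T)) + dim (S \<inter> T) \<le> dim S + dim T"
proof -
  obtain C where C: "C \<subseteq> S \<inter> T" "independent C" "S \<inter> T \<subseteq> span C" "card C = dim (S \<inter> T)"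
    by (rule basis_exists)
  obtain B where B: "C \<subseteq> B" "B \<subseteq> S" "independent B" "S \<subseteq> span B"
    using maximal_independent_subset_extend[of C S] C by auto
  have fin: "finite B" using B assms finite_indep by blast
  have "card B = dim S" using basis_card_eq_dim B by blast
  then have c: "card (B - C) = dim S - dim (S \<inter> T)" "dim (S \<inter> T) \<le> dim S"
    using B(1) C(4) fin card_mono[OF fin B(1)] by (auto simp: card_Diff_subset finite_subset)
  have "B \<subseteq> T \<union> (B - C)" using C(1) by blast
  then have "S \<subseteq> span (T \<union> (B - C))" using B(4) span_mono by blast
  then have "S \<union> T \<subseteq> span (T \<union> (B - C))"
    using span_superset by blast
  then have "dim (S \<union> T) \<le> dim (T \<union> (B - C))"
    using B(2) assms by (intro dim_le_of_subset_span) auto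
  also have "\<dots> \<le> dim T + card (B - C)"
    using fin B(2) assms by (intro dim_Un_le) auto
  finally show ?thesis using c by simp
qed

text \<open>The minimum of this bound over all \<open>V\<close> is the largest rank of a transversal.\<close>

definition rank_bound :: "('i \<Rightarrow> 'b set) \<Rightarrow> 'i set \<Rightarrow> 'b set \<Rightarrow> nat" where
  "rank_bound A J V = dim V + card {j \<in> J. \<not> A j \<subseteq> V}"

section \<open>Minimizers of the rank bound\<close>

definition minimizer :: "('i \<Rightarrow> 'b set) \<Rightarrow> 'i set \<Rightarrow> 'b set \<Rightarrow> bool" where
  "minimizer A J V \<longleftrightarrow> subspace V \<and> V \<subseteq> E \<and>
     (\<forall>W. subspace W \<longrightarrow> W \<subseteq> E \<longrightarrow> rank_bound A J V \<le> rank_bound A J W)"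

text \<open>The dimension part is \<open>dim_sum_Int_le\<close>. For the counting part, a set that
  is outside the sum is outside both subspaces, and one that is outside the intersection is outside
  at least one of them.\<close>

lemma rank_bound_submodular:
  assumes J: "finite J" and V: "subspace V" "V \<subseteq> E" and W: "subspace W" "W \<subseteq> E"
  shows "rank_bound A J (span (V \<union> W)) + rank_bound A J (V \<inter> W)
    \<le> rank_bound A J V + rank_bound A J W"
proof -
  let ?c = "\<lambda>V. {j \<in> J. \<not> A j \<subseteq> V}"
  have "card (?c (span (V \<union> W))) + card (?c (V \<inter> W))
      \<le> card (?c V \<inter> ?c W) + card (?c V \<union> ?c W)"
    using J span_superset[of "V \<union> W"] by (intro add_mono card_mono) auto
  also have "\<dots> = card (?c V) + card (?c W)"
    using card_Un_Int[of "?c V" "?c W"] J by simp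
  finally show ?thesis
    using dim_sum_Int_le[OF V(1) W(1) V(2) W(2)] by (simp add: rank_bound_def)
qed

lemma minimizer_lattice:
  assumes J: "finite J" and V: "minimizer A J V" and W: "minimizer A J W"
  shows "minimizer A J (span (V \<union> W))" "minimizer A J (V \<inter> W)"
proof -
  have sub: "subspace V" "V \<subseteq> E" "subspace W" "W \<subseteq> E"
    using V W by (auto simp: minimizer_def)
  have s: "span (V \<union> W) \<subseteq> E" using sub span_subset_E by auto
  have i: "subspace (V \<inter> W)" "V \<inter> W \<subseteq> E" using sub subspace_inter by auto
  have "rank_bound A J V = rank_bound A J W"
    using V W sub by (simp add: minimizer_def order_antisym)
  moreover have "rank_bound A J V \<le> rank_bound A J (span (V \<union> W))"
    "rank_bound A J V \<le> rank_bound A J (V \<inter> W)"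
    using V s i by (auto simp: minimizer_def)
  ultimately have "rank_bound A J (span (V \<union> W)) = rank_bound A J V"
    "rank_bound A J (V \<inter> W) = rank_bound A J V"
    using rank_bound_submodular[OF J sub, of A] by linarith+
  then show "minimizer A J (span (V \<union> W))" "minimizer A J (V \<inter> W)"
    using V s i by (auto simp: minimizer_def)
qed

lemma minimizer_exists: "\<exists>V. minimizer A J V"
proof -
  have "\<exists>V. (subspace V \<and> V \<subseteq> E) \<and>
      (\<forall>W. subspace W \<and> W \<subseteq> E \<longrightarrow> rank_bound A J V \<le> rank_bound A J W)"
    using subspace_E by (intro ex_has_least_nat[of _ E]) auto
  then show ?thesis unfolding minimizer_def by blast
qed

text \<open>Intersecting a minimizer of least dimension with any other one gives a minimizer again,
  of no smaller dimension, so nothing was cut away.\<close>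

lemma least_minimizer:
  assumes J: "finite J"
  obtains V where "minimizer A J V" "\<And>W. minimizer A J W \<Longrightarrow> V \<subseteq> W"
proof -
  obtain V0 where V0: "minimizer A J V0" using minimizer_exists by blast
  obtain V where V: "minimizer A J V" "\<And>W. minimizer A J W \<Longrightarrow> dim V \<le> dim W"
    using ex_has_least_nat[of "minimizer A J" V0 dim] V0 by blast
  have "V \<subseteq> W" if W: "minimizer A J W" for W
  proof -
    have "V \<inter> W = V"
      using minimizer_lattice(2)[OF J V(1) W] V
      by (intro subspace_eq_of_dim_le) (auto simp: minimizer_def)
    then show ?thesis by blast
  qed
  then show thesis using V(1) that by blast
qed

lemma greatest_minimizer:
  assumes J: "finite J"
  obtains V where "minimizer A J V" "\<And>W. minimizer A J W \<Longrightarrow> W \<subseteq> V"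
proof -
  obtain V0 where V0: "minimizer A J V0" using minimizer_exists by blast
  have "\<exists>V. minimizer A J V \<and> (\<forall>W. minimizer A J W \<longrightarrow> dim W \<le> dim V)"
  proof (rule ex_has_greatest_nat[where b = "Suc (dim E)"])
    show "\<forall>W. minimizer A J W \<longrightarrow> dim W < Suc (dim E)"
      using dim_le_of_subset_span[of _ E] span_superset[of E]
      by (auto simp: minimizer_def less_Suc_eq_le)
  qed (fact V0)
  then obtain V where V: "minimizer A J V" "\<And>W. minimizer A J W \<Longrightarrow> dim W \<le> dim V" by blast
  have "W \<subseteq> V" if W: "minimizer A J W" for W
  proof -
    have m: "minimizer A J (span (V \<union> W))" using minimizer_lattice(1)[OF J V(1) W] .
    then have "V = span (V \<union> W)"
      using V(1) V(2)[OF m] span_superset[of "V \<union> W"]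
      by (intro subspace_eq_of_dim_le) (auto simp: minimizer_def)
    then show ?thesis using span_superset[of "V \<union> W"] by blast
  qed
  then show thesis using V(1) that by blast
qed

text \<open>The points inside \<open>V\<close> contribute at most \<open>dim V\<close> to the rank,
  and every other point at most one.\<close>

lemma rank_le_rank_bound:
  assumes J: "finite J" and a: "\<And>j. j \<in> J \<Longrightarrow> a j \<in> A j" "\<And>j. j \<in> J \<Longrightarrow> A j \<subseteq> E"
    and V: "subspace V" "V \<subseteq> E"
  shows "dim (a ` J) \<le> rank_bound A J V"
proof -
  let ?O = "{j \<in> J. \<not> A j \<subseteq> V}"
  have "dim (a ` J) \<le> dim (V \<union> a ` ?O)"
  proof (rule dim_le_of_subset_span)
    have "a ` J \<subseteq> V \<union> a ` ?O" using a(1) by blast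
    then show "a ` J \<subseteq> span (V \<union> a ` ?O)" using span_superset by blast
    show "V \<union> a ` ?O \<subseteq> E" using V a by blast
  qed
  also have "\<dots> \<le> dim V + card (a ` ?O)"
    using J V a by (intro dim_Un_le) auto
  also have "\<dots> \<le> dim V + card ?O" using J by (simp add: card_image_le)
  finally show ?thesis by (simp add: rank_bound_def)
qed

text \<open>Shrink the sets to points one at a time. If no point of
  \<open>A j\<close> could replace \<open>A j\<close>, every point would lie in some minimizer for the other sets, so the
  greatest such minimizer would contain \<open>A j\<close> and violate the bound.\<close>

lemma rado_transversal:
  assumes J: "finite J" and A: "\<And>j. j \<in> J \<Longrightarrow> A j \<noteq> {}" "\<And>j. j \<in> J \<Longrightarrow> A j \<subseteq> E"
    and bound: "\<And>V. subspace V \<Longrightarrow> V \<subseteq> E \<Longrightarrow> \<rho> \<le> rank_bound A J V"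
  obtains a where "\<And>j. j \<in> J \<Longrightarrow> a j \<in> A j" "\<rho> \<le> dim (a ` J)"
proof -
  \<comment> \<open>\<open>I\<close> collects the indices whose sets may still be larger than a
    point; \<open>A\<close> must vary because each step replaces one set by a singleton.\<close>
  have shrink: "\<exists>a. (\<forall>j\<in>J. a j \<in> A j) \<and> \<rho> \<le> dim (a ` J)"
    if "I \<subseteq> J" "\<And>j. j \<in> J - I \<Longrightarrow> \<exists>x. A j = {x}"
      "\<And>j. j \<in> J \<Longrightarrow> A j \<noteq> {}" "\<And>j. j \<in> J \<Longrightarrow> A j \<subseteq> E"
      "\<And>V. subspace V \<Longrightarrow> V \<subseteq> E \<Longrightarrow> \<rho> \<le> rank_bound A J V" for A I
    using finite_subset[OF that(1) J] that
  proof (induction I arbitrary: A rule: finite_induct)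
    case empty
    obtain a where a: "\<And>j. j \<in> J \<Longrightarrow> A j = {a j}" using empty.prems(2) by (metis Diff_empty)
    have "a ` J \<subseteq> E" using a empty.prems(4) by auto
    then have "\<rho> \<le> rank_bound A J (span (a ` J))"
      using empty.prems(5) span_subset_E by blast
    moreover have "{j \<in> J. \<not> A j \<subseteq> span (a ` J)} = {}" using a span_base by auto
    ultimately have "\<rho> \<le> dim (a ` J)" by (simp add: rank_bound_def del: Collect_empty_eq)
    then show ?case using a by (intro exI[of _ a]) auto
  next
    case (insert j I)
    have j: "j \<in> J" using insert.prems(1) by blast
    have split: "rank_bound B J V = rank_bound B (J - {j}) V + (if B j \<subseteq> V then 0 else 1)" for B V
    proof -
      have "{i \<in> J. \<not> B i \<subseteq> V}
          = {i \<in> J - {j}. \<not> B i \<subseteq> V} \<union> (if B j \<subseteq> V then {} else {j})"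
        using j by auto
      then show ?thesis using J by (auto simp: rank_bound_def)
    qed
    have upd: "rank_bound (A(j := X)) (J - {j}) V = rank_bound A (J - {j}) V" for X V
    proof -
      have "{i \<in> J - {j}. \<not> (A(j := X)) i \<subseteq> V} = {i \<in> J - {j}. \<not> A i \<subseteq> V}" by auto
      then show ?thesis by (simp add: rank_bound_def)
    qed
    have "\<exists>x\<in>A j. \<forall>V. subspace V \<longrightarrow> V \<subseteq> E \<longrightarrow> \<rho> \<le> rank_bound (A(j := {x})) J V"
    proof (rule ccontr)
      assume "\<not> ?thesis"
      then have neg: "\<exists>V. subspace V \<and> V \<subseteq> E \<and>
          rank_bound A (J - {j}) V + (if x \<in> V then 0 else 1) < \<rho>" if "x \<in> A j" for x
        using that split[of "A(j := {x})"] upd by (fastforce simp: not_le)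
      have low: "\<rho> \<le> rank_bound A (J - {j}) V + (if A j \<subseteq> V then 0 else 1)"
        if "subspace V" "V \<subseteq> E" for V
        using insert.prems(5)[OF that] split[of A] by simp
      obtain V where V: "minimizer A (J - {j}) V" "\<And>W. minimizer A (J - {j}) W \<Longrightarrow> W \<subseteq> V"
        using greatest_minimizer[of "J - {j}"] J by blast
      have "x \<in> V" if x: "x \<in> A j" for x
      proof -
        obtain W where W: "subspace W" "W \<subseteq> E"
          "rank_bound A (J - {j}) W + (if x \<in> W then 0 else 1) < \<rho>"
          using neg[OF x] by blast
        \<comment> \<open>For \<open>x\<close> outside \<open>W\<close> the bound in
          \<open>W(3)\<close> would have the summand 1, and \<open>low\<close> already says that
          \<open>\<rho>\<close> is at most that value.\<close>
        have xW: "x \<in> W" and rW: "rank_bound A (J - {j}) W + 1 \<le> \<rho>"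
          using W(3) low[OF W(1,2)] by (auto split: if_splits)
        have "minimizer A (J - {j}) W"
          unfolding minimizer_def
        proof (intro conjI allI impI)
          fix U assume "subspace U" "U \<subseteq> E"
          then show "rank_bound A (J - {j}) W \<le> rank_bound A (J - {j}) U"
            using low[of U] rW by (auto split: if_splits)
        qed (fact W)+
        then show ?thesis using V(2) xW by blast
      qed
      then have "A j \<subseteq> V" by blast
      moreover have "subspace V" "V \<subseteq> E" using V(1) by (auto simp: minimizer_def)
      ultimately have ge: "\<rho> \<le> rank_bound A (J - {j}) V" using low[of V] by simp
      obtain x where "x \<in> A j" using insert.prems(3)[OF j] by blast
      then obtain W where "subspace W" "W \<subseteq> E" "rank_bound A (J - {j}) W < \<rho>"
        using neg by (metis add_lessD1)
      then show False using V(1) ge unfolding minimizer_def by fastforce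
    qed
    then obtain x where x: "x \<in> A j"
      "\<And>V. subspace V \<Longrightarrow> V \<subseteq> E \<Longrightarrow> \<rho> \<le> rank_bound (A(j := {x})) J V" by blast
    have "\<exists>a. (\<forall>i\<in>J. a i \<in> (A(j := {x})) i) \<and> \<rho> \<le> dim (a ` J)"
    proof (rule insert.IH)
      show "I \<subseteq> J" using insert.prems(1) by blast
      show "\<exists>y. (A(j := {x})) i = {y}" if "i \<in> J - I" for i
        using that insert.prems(2)[of i] by auto
      show "(A(j := {x})) i \<noteq> {}" if "i \<in> J" for i using that insert.prems(3) by auto
      show "(A(j := {x})) i \<subseteq> E" if "i \<in> J" for i using that insert.prems(4) x(1) by (auto split: if_splits)
    qed (fact x(2))
    then obtain a where a: "\<forall>i\<in>J. a i \<in> (A(j := {x})) i" "\<rho> \<le> dim (a ` J)" by blast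
    have "a i \<in> A i" if "i \<in> J" for i
      using that a(1) x(1) by (cases "i = j") auto
    then show ?case using a(2) by blast
  qed
  show thesis using shrink[OF order_refl, of A] A bound that by blast
qed

subsection \<open>Families of flats all of whose transversals are independent or spanning\<close>

text \<open>Closure uses three points rather than the line through two: over the field with two
  elements every set contains the lines through its points, whereas this condition gives affine
  subspaces over every field.\<close>

definition flat :: "'b set \<Rightarrow> bool" where
  "flat A \<longleftrightarrow> A \<noteq> {} \<and> (\<forall>x\<in>A. \<forall>y\<in>A. \<forall>z\<in>A. \<forall>t. x + scale t (y - z) \<in> A)"

definition direction :: "'b set \<Rightarrow> 'b set" where
  "direction A = {y - x |x y. x \<in> A \<and> y \<in> A}"

lemma diff_in_direction: "x \<in> A \<Longrightarrow> y \<in> A \<Longrightarrow> y - x \<in> direction A"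
  by (auto simp: direction_def)

lemma flat_add_direction:
  "flat A \<Longrightarrow> a \<in> A \<Longrightarrow> d \<in> direction A \<Longrightarrow> a + scale t d \<in> A"
  by (auto simp: flat_def direction_def)

lemma flat_plus_direction: "flat A \<Longrightarrow> a \<in> A \<Longrightarrow> d \<in> direction A \<Longrightarrow> a + d \<in> A"
  using flat_add_direction[of A a d 1] by simp

lemma subspace_direction:
  assumes "flat A"
  shows "subspace (direction A)"
proof (rule subspaceI)
  show "0 \<in> direction A" using assms by (auto simp: flat_def direction_def)
next
  fix d e assume d: "d \<in> direction A" and e: "e \<in> direction A"
  obtain x y where xy: "d = y - x" "x \<in> A" "y \<in> A" using d by (auto simp: direction_def)
  have "y + e \<in> A" using flat_plus_direction[OF assms xy(3) e] .
  from diff_in_direction[OF xy(2) this] show "d + e \<in> direction A"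
    by (simp add: xy(1) algebra_simps)
next
  fix c d assume d: "d \<in> direction A"
  obtain x where x: "x \<in> A" using assms by (auto simp: flat_def)
  have "x + scale c d \<in> A" using flat_add_direction[OF assms x d] .
  from diff_in_direction[OF x this] show "scale c d \<in> direction A" by simp
qed

lemma direction_subset_subspace:
  "subspace P \<Longrightarrow> A \<subseteq> P \<Longrightarrow> direction A \<subseteq> P"
  by (auto simp: direction_def intro: subspace_diff)

lemma flat_subspace: "subspace P \<Longrightarrow> flat P"
  unfolding flat_def by (auto intro: subspace_add subspace_scale subspace_diff dest: subspace_0)

lemma flat_Int_subspace:
  assumes "flat A" "subspace P" "A \<inter> P \<noteq> {}"
  shows "flat (A \<inter> P)"
proof -
  have "x + scale t (y - z) \<in> P" if "x \<in> P" "y \<in> P" "z \<in> P" for x y z t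
    using that assms(2) by (intro subspace_add subspace_scale subspace_diff)
  then show ?thesis using assms unfolding flat_def by blast
qed

text \<open>A flat is generated by one of its points and its directions, so modulo
  \<open>span H\<close> only one scalar and one direction are left.\<close>

lemma span_Un_flat:
  assumes "flat A" "a \<in> A" "x \<in> span (H \<union> A)"
  obtains h t d where "h \<in> span H" "d \<in> direction A" "x = h + scale t a + d"
proof -
  have "A \<subseteq> span (insert a (H \<union> direction A))"
  proof
    fix y assume "y \<in> A"
    then have "y - a \<in> direction A" using assms(2) diff_in_direction by blast
    then have "a + (y - a) \<in> span (insert a (H \<union> direction A))"
      by (intro span_add span_base) auto
    then show "y \<in> span (insert a (H \<union> direction A))" by simp
  qed
  moreover have "H \<subseteq> span (insert a (H \<union> direction A))"
    by (auto intro: span_base)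
  ultimately have "span (H \<union> A) \<subseteq> span (insert a (H \<union> direction A))"
    by (intro span_minimal) auto
  then obtain t where "x - scale t a \<in> span (H \<union> direction A)"
    using assms(3) span_breakdown_eq by blast
  then obtain h d where h: "h \<in> span H" "d \<in> span (direction A)" "x - scale t a = h + d"
    unfolding span_Un by blast
  have "d \<in> direction A" using h(2) subspace_direction[OF assms(1)] by (metis span_eq_iff)
  moreover have "x = h + scale t a + d" using h(3) by (simp add: algebra_simps)
  ultimately show thesis using h(1) that by blast
qed

text \<open>Join a point outside \<open>Q i\<close> to a point outside all the other subspaces. Two
  points of this line in the same subspace would put both ends into it, so the line, with |F|
  parameters, needs |F| different subspaces. The strict bound is sharp: an affine line missing the
  origin is covered by the |F| lines spanned by its points.\<close>

lemma flat_subset_of_cover: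
  assumes "finite I" "infinite (UNIV :: 'a set) \<or> card I < card (UNIV :: 'a set)"
    and A: "flat A" and Q: "\<And>i. i \<in> I \<Longrightarrow> subspace (Q i)" and cover: "A \<subseteq> (\<Union>i\<in>I. Q i)"
  shows "\<exists>i\<in>I. A \<subseteq> Q i"
  using assms(1,2) Q cover
proof (induction I rule: finite_induct)
  case empty
  then show ?case using A by (auto simp: flat_def)
next
  case (insert i I)
  show ?case
  proof (rule ccontr)
    assume no: "\<not> ?case"
    then obtain x where x: "x \<in> A" "x \<notin> Q i" by auto
    have "\<not> A \<subseteq> (\<Union>i\<in>I. Q i)"
      using no insert by auto
    then obtain y where y: "y \<in> A" "\<And>k. k \<in> I \<Longrightarrow> y \<notin> Q k" by auto
    have "x + scale t (y - x) \<in> A" for t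
      using A x(1) y(1) by (simp add: flat_def)
    then have "\<exists>k\<in>insert i I. x + scale t (y - x) \<in> Q k" for t
      using insert.prems(3) by fast
    then obtain k where k: "\<And>t. k t \<in> insert i I" "\<And>t. x + scale t (y - x) \<in> Q (k t)"
      by metis
    have "inj k"
    proof (rule injI, rule ccontr)
      fix t u assume eq: "k t = k u" and ne: "t \<noteq> u"
      have sub: "subspace (Q (k t))" using k(1) insert.prems(2) by blast
      have "(x + scale t (y - x)) - (x + scale u (y - x)) \<in> Q (k t)"
        using k(2)[of t] k(2)[of u] eq sub subspace_diff by metis
      then have "scale (t - u) (y - x) \<in> Q (k t)" by (simp add: scale_left_diff_distrib)
      then have "scale (inverse (t - u)) (scale (t - u) (y - x)) \<in> Q (k t)"
        using sub subspace_scale by blast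
      then have yx: "y - x \<in> Q (k t)" using ne by simp
      have "(x + scale t (y - x)) - scale t (y - x) \<in> Q (k t)"
        using subspace_diff[OF sub k(2)] subspace_scale[OF sub yx] by blast
      then have xQ: "x \<in> Q (k t)" by simp
      have "x + (y - x) \<in> Q (k t)" using subspace_add[OF sub xQ yx] .
      then have "y \<in> Q (k t)" by simp
      then show False using xQ x(2) y(2) k(1)[of t] by blast
    qed
    moreover have "range k \<subseteq> insert i I" using k(1) by blast
    ultimately have "finite (UNIV :: 'a set)" "card (UNIV :: 'a set) \<le> card (insert i I)"
      using insert.hyps(1) by (auto intro: inj_on_finite card_inj_on_le)
    then show False using insert.prems(1) by auto
  qed
qed

text \<open>Independence of an indexed family in the quotient by \<open>span K\<close>; a vector
  that occurs under two indices makes the family dependent.\<close>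

definition indep_mod :: "'b set \<Rightarrow> ('i \<Rightarrow> 'b) \<Rightarrow> 'i set \<Rightarrow> bool" where
  "indep_mod K a J \<longleftrightarrow> (\<forall>j\<in>J. a j \<notin> span (K \<union> a ` (J - {j})))"

text \<open>Fixing a point \<open>x\<close> of \<open>A n\<close> and applying the induction hypothesis modulo \<open>x\<close> yields an index
  \<open>j\<close> depending on \<open>x\<close>; the points with the same \<open>j\<close> lie in one subspace \<open>Q j\<close>, and a flat covered
  by few subspaces lies in one of them, so a single \<open>j\<close> works for all \<open>x\<close>.\<close>

lemma exists_flat_avoiding_others:
  assumes "finite J" "J \<noteq> {}"
    and "infinite (UNIV :: 'a set) \<or> card J \<le> card (UNIV :: 'a set)"
    and "\<And>j. j \<in> J \<Longrightarrow> flat (A j)"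
    and "\<And>a. (\<And>j. j \<in> J \<Longrightarrow> a j \<in> A j) \<Longrightarrow> indep_mod K a J"
  shows "\<exists>j\<in>J. A j \<inter> span (K \<union> \<Union>(A ` (J - {j}))) = {}"
  using assms
proof (induction J arbitrary: K rule: finite_ne_induct)
  case (singleton j)
  have "y \<notin> span K" if "y \<in> A j" for y
    using singleton(3)[of "\<lambda>_. y"] that by (auto simp: indep_mod_def)
  then show ?case by auto
next
  case (insert n J)
  define P where "P = span (K \<union> \<Union>(A ` J))"
  define H where "H j = K \<union> \<Union>(A ` (J - {j}))" for j
  define I where "I = {j \<in> J. A j \<inter> span (H j) = {}}"
  have IH: "\<exists>j\<in>J. A j \<inter> span (insert x (H j)) = {}" if x: "x \<in> A n" for x
  proof -
    have "\<exists>j\<in>J. A j \<inter> span (insert x K \<union> \<Union>(A ` (J - {j}))) = {}"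
    proof (rule insert.IH)
      show "infinite (UNIV :: 'a set) \<or> card J \<le> card (UNIV :: 'a set)"
        using insert.prems(1) insert.hyps by auto
      show "flat (A j)" if "j \<in> J" for j using that insert.prems(2) by blast
      show "indep_mod (insert x K) a J" if a: "\<And>j. j \<in> J \<Longrightarrow> a j \<in> A j" for a
        unfolding indep_mod_def
      proof
        fix j assume j: "j \<in> J"
        have "indep_mod K (a(n := x)) (insert n J)"
          using a x by (intro insert.prems(3)) auto
        then have "(a(n := x)) j \<notin> span (K \<union> (a(n := x)) ` (insert n J - {j}))"
          using j by (simp add: indep_mod_def del: fun_upd_apply)
        moreover have "K \<union> (a(n := x)) ` (insert n J - {j}) = insert x K \<union> a ` (J - {j})"
          using insert.hyps(3) j by auto
        moreover have "(a(n := x)) j = a j" using insert.hyps(3) j by auto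
        ultimately show "a j \<notin> span (insert x K \<union> a ` (J - {j}))" by simp
      qed
    qed
    then show ?thesis by (simp add: H_def)
  qed
  show ?case
  proof (cases "A n \<inter> P = {}")
    case True
    moreover have "insert n J - {n} = J" using insert.hyps(3) by blast
    ultimately show ?thesis by (auto simp: P_def)
  next
    case False
    define Q where "Q j = span (H j \<union> direction (A j))" for j
    have P_eq: "P = span (H j \<union> A j)" if "j \<in> J" for j
      unfolding P_def H_def using that by (intro arg_cong[of _ _ span]) auto
    have "\<exists>j\<in>I. A n \<inter> P \<subseteq> Q j"
    proof (rule flat_subset_of_cover)
      show "finite I" using insert.hyps(1) by (simp add: I_def)
      \<comment> \<open>\<open>J\<close> has one element fewer than \<open>insert n J\<close>, which
        turns the weak cardinality hypothesis into the strict one of the covering lemma.\<close>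
      have "card I \<le> card J" unfolding I_def using insert.hyps(1) by (intro card_mono) auto
      then show "infinite (UNIV :: 'a set) \<or> card I < card (UNIV :: 'a set)"
        using insert.prems(1) insert.hyps by auto
      show "flat (A n \<inter> P)"
        using False insert.prems(2) by (intro flat_Int_subspace) (auto simp: P_def)
      show "subspace (Q j)" for j by (simp add: Q_def)
      show "A n \<inter> P \<subseteq> (\<Union>j\<in>I. Q j)"
      proof
        fix x assume x: "x \<in> A n \<inter> P"
        obtain j where j: "j \<in> J" "A j \<inter> span (insert x (H j)) = {}" using IH x by blast
        have "j \<in> I" using j span_mono[of "H j" "insert x (H j)"] by (auto simp: I_def)
        moreover have "x \<in> Q j"
        proof -
          have fl: "flat (A j)" using insert.prems(2) j(1) by blast
          then obtain b where b: "b \<in> A j" by (auto simp: flat_def)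
          have "x \<in> span (H j \<union> A j)" using x P_eq[OF j(1)] by blast
          then obtain h t d where h: "h \<in> span (H j)" "d \<in> direction (A j)"
            "x = h + scale t b + d"
            using span_Un_flat[OF fl b] by metis
          \<comment> \<open>Otherwise dividing by \<open>t\<close> produces a point of
            \<open>A j\<close> in \<open>span (insert x (H j))\<close>, against the choice of
            \<open>j\<close> for \<open>x\<close>. With \<open>t = 0\<close> the point
            \<open>x\<close> has no component along \<open>b\<close> and falls into
            \<open>Q j\<close>.\<close>
          have "t = 0"
          proof (rule ccontr)
            assume t: "t \<noteq> 0"
            have "b + scale (inverse t) d \<in> A j" using flat_add_direction[OF fl b h(2)] .
            moreover have "b + scale (inverse t) d = scale (inverse t) (x - h)"
              using t h(3) by (simp add: scale_right_distrib algebra_simps)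
            moreover have "scale (inverse t) (x - h) \<in> span (insert x (H j))"
              using h(1) span_mono[of "H j" "insert x (H j)"]
              by (intro span_scale span_diff) (auto intro: span_base)
            ultimately show False using j(2) by auto
          qed
          then have "x = h + d" using h(3) by simp
          then show ?thesis using h(1,2) unfolding Q_def span_Un using span_base by blast
        qed
        ultimately show "x \<in> (\<Union>j\<in>I. Q j)" by blast
      qed
    qed
    then obtain j where j: "j \<in> J" "A j \<inter> span (H j) = {}" "A n \<inter> P \<subseteq> Q j"
      by (auto simp: I_def)
    have sQ: "subspace (Q j)" and sP: "subspace P" by (auto simp: Q_def P_def)
    have fl: "flat (A j)" "flat (A n)" using insert.prems(2) j(1) by auto
    obtain a where a: "a \<in> A n" "a \<in> P" using False by blast
    have HP: "span (H j) \<subseteq> P" unfolding P_eq[OF j(1)] by (rule span_mono) blast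
    have HQ: "span (H j) \<subseteq> Q j" unfolding Q_def by (rule span_mono) blast
    have AP: "A j \<subseteq> P" unfolding P_eq[OF j(1)] using span_superset by blast
    \<comment> \<open>A point \<open>y\<close> of \<open>A j\<close> in this span would lie in
      \<open>P\<close>, so the direction \<open>d\<close> of \<open>A n\<close> used to write it
      stays inside \<open>P\<close>. Then the inclusion of \<open>A n \<inter> P\<close> in
      \<open>Q j\<close> puts \<open>y\<close> into \<open>Q j\<close>, and removing its direction
      part leaves a point of \<open>A j\<close> in \<open>span (H j)\<close>.\<close>
    have "y \<notin> span (K \<union> \<Union>(A ` (insert n J - {j})))" if y: "y \<in> A j" for y
    proof
      assume "y \<in> span (K \<union> \<Union>(A ` (insert n J - {j})))"
      moreover have "K \<union> \<Union>(A ` (insert n J - {j})) = H j \<union> A n"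
        using insert.hyps(3) j(1) by (auto simp: H_def)
      ultimately have "y \<in> span (H j \<union> A n)" by simp
      then obtain h t d where h: "h \<in> span (H j)" "d \<in> direction (A n)" "y = h + scale t a + d"
        using span_Un_flat[OF fl(2) a(1)] by metis
      have "y - h - scale t a \<in> P"
        using y AP h(1) HP a(2) sP by (intro subspace_diff subspace_scale) auto
      then have dP: "d \<in> P" using h(3) by simp
      have "a + d \<in> Q j"
        using flat_plus_direction[OF fl(2) a(1) h(2)] subspace_add[OF sP a(2) dP] j(3) by blast
      moreover have aQ: "a \<in> Q j" using a j(3) by blast
      ultimately have "d \<in> Q j" using subspace_diff[OF sQ, of "a + d" a] by simp
      then have "y \<in> Q j" unfolding h(3)
        using h(1) HQ aQ sQ by (intro subspace_add subspace_scale) auto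
      then obtain h' d' where h': "h' \<in> span (H j)" "d' \<in> span (direction (A j))" "y = h' + d'"
        unfolding Q_def span_Un by blast
      have "d' \<in> direction (A j)" using h'(2) subspace_direction[OF fl(1)] by (metis span_eq_iff)
      then have "y + scale (- 1) d' \<in> A j" using flat_add_direction[OF fl(1) y] by blast
      then have "h' \<in> A j" using h'(3) by simp
      then show False using h'(1) j(2) by blast
    qed
    then show ?thesis using j(1) by blast
  qed
qed

text \<open>Maximality is by dimension and is recorded against adjoining a single vector, the form
  in which both peeling arguments use it.\<close>

lemma exists_maximal_subspace:
  assumes "P H" "subspace H" "H \<subseteq> V" "V \<subseteq> E" "subspace V"
  obtains G where "P G" "subspace G" "G \<subseteq> V"
    "\<And>x. x \<in> V \<Longrightarrow> P (span (insert x G)) \<Longrightarrow> x \<in> G"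
proof -
  let ?P = "\<lambda>G. P G \<and> subspace G \<and> G \<subseteq> V"
  have "\<exists>G. ?P G \<and> (\<forall>G'. ?P G' \<longrightarrow> dim G' \<le> dim G)"
  proof (rule ex_has_greatest_nat[where k = H and b = "Suc (dim V)"])
    show "\<forall>G'. ?P G' \<longrightarrow> dim G' < Suc (dim V)"
      using dim_le_of_subset_span[of _ V] span_superset[of V] assms(4)
      by (auto simp: less_Suc_eq_le)
  qed (use assms in blast)
  then obtain G where G: "?P G" "\<And>G'. ?P G' \<Longrightarrow> dim G' \<le> dim G" by blast
  have "x \<in> G" if x: "x \<in> V" "P (span (insert x G))" for x
  proof (rule ccontr)
    assume "x \<notin> G"
    then have "x \<notin> span G" using G(1) by (metis span_eq_iff)
    then have "dim (insert x G) = Suc (dim G)"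
      using G(1) x(1) assms(4) by (intro dim_insert_notin) auto
    moreover have "span (insert x G) \<subseteq> V"
      using G(1) x(1) assms(5) by (intro span_minimal) auto
    then have "dim (span (insert x G)) \<le> dim G" using x(2) by (intro G(2)) simp
    ultimately show False by simp
  qed
  then show thesis using G(1) that by blast
qed

lemma relative_basis_list:
  assumes "subspace K" "subspace V" "K \<subseteq> V" "V \<subseteq> E"
  obtains bs where "span (K \<union> set bs) = V" "dim V = dim K + length bs"
proof -
  obtain C where C: "C \<subseteq> K" "independent C" "K \<subseteq> span C" "card C = dim K"
    by (rule basis_exists)
  obtain B where B: "C \<subseteq> B" "B \<subseteq> V" "independent B" "V \<subseteq> span B"
    using maximal_independent_subset_extend[of C V] C assms by (metis subset_trans)
  have fin: "finite B" using B assms finite_indep by blast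
  obtain bs where bs: "set bs = B - C" "distinct bs" using fin finite_distinct_list by blast
  have "length bs = card (B - C)" using bs distinct_card by metis
  also have "\<dots> = dim V - dim K"
    using B C fin basis_card_eq_dim[OF B(2,4,3)] by (simp add: card_Diff_subset finite_subset)
  finally have "dim V = dim K + length bs"
    using card_mono[OF fin B(1)] basis_card_eq_dim[OF B(2,4,3)] C(4) by simp
  moreover have "span (K \<union> set bs) = V"
  proof
    show "span (K \<union> set bs) \<subseteq> V" using bs B(2) assms by (intro span_minimal) auto
    have "span B \<subseteq> span (K \<union> set bs)" using bs C(1) by (intro span_mono) auto
    then show "V \<subseteq> span (K \<union> set bs)" using B(4) by blast
  qed
  ultimately show thesis using that by blast
qed

text \<open>Peeling goes from the last column backwards. A column that avoids the span of the others
  misses some hyperplane \<open>G\<close> of \<open>V\<close> containing them; it lies in one coset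
  of \<open>G\<close>, so it becomes the last pivot, and the induction continues inside
  \<open>G\<close>. The pivots therefore occupy the last positions of \<open>bs\<close>, which
  explains the offset \<open>length bs - length js\<close>.\<close>

lemma independent_flats_flag:
  assumes "finite J" "infinite (UNIV :: 'a set) \<or> card J \<le> card (UNIV :: 'a set)"
    and "\<And>j. j \<in> J \<Longrightarrow> flat (A j)" "\<And>j. j \<in> J \<Longrightarrow> A j \<subseteq> V"
    and "subspace K" "subspace V" "K \<subseteq> V" "V \<subseteq> E"
    and "\<And>a. (\<And>j. j \<in> J \<Longrightarrow> a j \<in> A j) \<Longrightarrow> indep_mod K a J"
  shows "\<exists>bs js. set js = J \<and> distinct js \<and> length js \<le> length bs \<and>
    dim V = dim K + length bs \<and> span (K \<union> set bs) = V \<and>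
    (\<forall>k<length js. \<forall>y\<in>A (js ! k). y - bs ! (length bs - length js + k)
       \<in> span (K \<union> set (take (length bs - length js + k) bs)))"
  using assms
proof (induction "card J" arbitrary: J V)
  case 0
  then have "J = {}" by simp
  moreover obtain bs where "span (K \<union> set bs) = V" "dim V = dim K + length bs"
    using relative_basis_list 0 by metis
  ultimately show ?case by (intro exI[of _ bs] exI[of _ "[]"]) auto
next
  case (Suc c)
  have "J \<noteq> {}" using Suc.hyps(2) by auto
  then have "\<exists>j\<in>J. A j \<inter> span (K \<union> \<Union>(A ` (J - {j}))) = {}"
    using Suc.prems by (intro exists_flat_avoiding_others) auto
  then obtain j where j: "j \<in> J" "A j \<inter> span (K \<union> \<Union>(A ` (J - {j}))) = {}" by blast
  have fl: "flat (A j)" "A j \<subseteq> V" using Suc.prems j by auto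
  let ?H = "span (K \<union> \<Union>(A ` (J - {j})))"
  have HV: "?H \<subseteq> V" using Suc.prems(4,6,7) by (intro span_minimal) auto
  \<comment> \<open>\<open>G\<close> will turn out to be the hyperplane spanned by all basis vectors
    before the last one.\<close>
  obtain G where G: "?H \<subseteq> G \<and> A j \<inter> G = {}" "subspace G" "G \<subseteq> V"
    "\<And>x. x \<in> V \<Longrightarrow> ?H \<subseteq> span (insert x G) \<and> A j \<inter> span (insert x G) = {} \<Longrightarrow> x \<in> G"
    by (rule exists_maximal_subspace[of "\<lambda>G. ?H \<subseteq> G \<and> A j \<inter> G = {}" ?H V])
      (use j(2) Suc.prems(6,8) HV in simp_all)
  have meet: "\<exists>y\<in>A j. \<exists>k. k \<noteq> 0 \<and> y - scale k x \<in> G" if x: "x \<in> V" "x \<notin> G" for x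
  proof -
    have "?H \<subseteq> span (insert x G)" using G(1) span_superset[of "insert x G"] by blast
    then obtain y where y: "y \<in> A j" "y \<in> span (insert x G)" using G(4) x by blast
    then obtain k where k: "y - scale k x \<in> span G" using span_breakdown_eq by blast
    then have "y - scale k x \<in> G" using G(2) by (metis span_eq_iff)
    moreover have "k \<noteq> 0" using calculation y(1) G(1) by auto
    ultimately show ?thesis using y(1) by blast
  qed
  \<comment> \<open>A direction of \<open>A j\<close> outside \<open>G\<close> could be used to
    slide a point of \<open>A j\<close> into \<open>G\<close>, by \<open>meet\<close>.\<close>
  have dirG: "direction (A j) \<subseteq> G"
  proof (rule ccontr)
    assume "\<not> ?thesis"
    then obtain d where d: "d \<in> direction (A j)" "d \<notin> G" by blast
    have "d \<in> V" using d direction_subset_subspace[OF Suc.prems(6) fl(2)] by blast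
    then obtain y k where "y \<in> A j" "y - scale k d \<in> G" using meet d(2) by blast
    moreover have "y + scale (- k) d \<in> A j"
      using flat_add_direction[OF fl(1) \<open>y \<in> A j\<close> d(1)] .
    ultimately show False using G(1) by auto
  qed
  obtain a where a: "a \<in> A j" using fl(1) by (auto simp: flat_def)
  have aG: "a \<notin> G" "a \<in> V" using a G(1) fl(2) by auto
  \<comment> \<open>Modulo \<open>G\<close> all points of \<open>A j\<close> equal \<open>a\<close>,
    and by \<open>meet\<close> every vector outside \<open>G\<close> is a multiple of such a point.
    Hence \<open>G\<close> has codimension one.\<close>
  have VG: "span (insert a G) = V"
  proof
    show "span (insert a G) \<subseteq> V" using aG G(3) Suc.prems(6) by (intro span_minimal) auto
    show "V \<subseteq> span (insert a G)"
    proof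
      fix x assume x: "x \<in> V"
      show "x \<in> span (insert a G)"
      proof (cases "x \<in> G")
        case False
        then obtain y k where y: "y \<in> A j" "k \<noteq> 0" "y - scale k x \<in> G" using meet x by blast
        have "y - a \<in> G" using diff_in_direction[OF a y(1)] dirG by blast
        then have "scale (inverse k) ((y - a) + a - (y - scale k x)) \<in> span (insert a G)"
          using y(3) by (intro span_scale span_diff span_add span_base) auto
        then show ?thesis using y(2) by simp
      qed (auto intro: span_base)
    qed
  qed
  have "\<exists>bs js. set js = J - {j} \<and> distinct js \<and> length js \<le> length bs \<and>
    dim G = dim K + length bs \<and> span (K \<union> set bs) = G \<and>
    (\<forall>k<length js. \<forall>y\<in>A (js ! k). y - bs ! (length bs - length js + k)
       \<in> span (K \<union> set (take (length bs - length js + k) bs)))"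
  proof (rule Suc.hyps(1))
    show "c = card (J - {j})" using Suc.hyps(2) j(1) Suc.prems(1) by simp
    show "infinite (UNIV :: 'a set) \<or> card (J - {j}) \<le> card (UNIV :: 'a set)"
      using Suc.prems(1,2) card_Diff1_le[of J j] by linarith
    show "A i \<subseteq> G" if "i \<in> J - {j}" for i
      using that G(1) span_superset[of "K \<union> \<Union>(A ` (J - {j}))"] by blast
    show "K \<subseteq> G" using G(1) span_superset[of "K \<union> \<Union>(A ` (J - {j}))"] by blast
    show "G \<subseteq> E" using G(3) Suc.prems(8) by blast
    show "indep_mod K b (J - {j})" if b: "\<And>i. i \<in> J - {j} \<Longrightarrow> b i \<in> A i" for b
    proof -
      have im: "indep_mod K (b(j := a)) J" using b a by (intro Suc.prems(9)) auto
      show ?thesis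
        unfolding indep_mod_def
      proof
        fix i assume i: "i \<in> J - {j}"
        have "span (K \<union> b ` (J - {j} - {i})) \<subseteq> span (K \<union> (b(j := a)) ` (J - {i}))"
          by (intro span_mono) auto
        moreover have "(b(j := a)) i \<notin> span (K \<union> (b(j := a)) ` (J - {i}))"
          using im i unfolding indep_mod_def by blast
        ultimately show "b i \<notin> span (K \<union> b ` (J - {j} - {i}))" using i by auto
      qed
    qed
  qed (use Suc.prems G in auto)
  then obtain bs js where IH: "set js = J - {j}" "distinct js" "length js \<le> length bs"
    "dim G = dim K + length bs" "span (K \<union> set bs) = G"
    "\<And>k y. k < length js \<Longrightarrow> y \<in> A (js ! k) \<Longrightarrow> y - bs ! (length bs - length js + k)
       \<in> span (K \<union> set (take (length bs - length js + k) bs))" by blast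
  have "dim (insert a G) = Suc (dim G)"
    using aG G(2,3) Suc.prems(8) by (intro dim_insert_notin) (auto simp: span_eq_iff[THEN iffD2])
  then have "dim V = Suc (dim G)" using VG by (metis dim_span)
  moreover have "span (K \<union> set (bs @ [a])) = V"
  proof -
    have "span (K \<union> set (bs @ [a])) = span (insert a (K \<union> set bs))" by simp
    also have "\<dots> = span (insert a G)"
      unfolding IH(5)[symmetric] span_insert span_span by simp
    finally show ?thesis using VG by simp
  qed
  moreover have "y - (bs @ [a]) ! (length (bs @ [a]) - length (js @ [j]) + k)
       \<in> span (K \<union> set (take (length (bs @ [a]) - length (js @ [j]) + k) (bs @ [a])))"
    if k: "k < length (js @ [j])" and y: "y \<in> A ((js @ [j]) ! k)" for k y
  proof (cases "k < length js")
    case True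
    then have "length bs - length js + k < length bs" using IH(3) by simp
    then show ?thesis using IH(6)[of k y] y True by (simp add: nth_append del: Nat.add_diff_assoc2)
  next
    case False
    then have "k = length js" using k by simp
    moreover have "y - a \<in> G" using calculation y a dirG diff_in_direction by auto
    ultimately show ?thesis using IH(3,5) by simp
  qed
  ultimately show ?case
    using IH(1-4) j(1)
    by (intro exI[of _ "bs @ [a]"] exI[of _ "js @ [j]"]) (auto simp del: take_append)
qed

text \<open>Otherwise choose a direction \<open>l j \<notin> K\<close> of every \<open>A j\<close> not contained in \<open>K\<close>. A subspace \<open>H\<close> above
  \<open>K\<close> that is maximal among those avoiding all \<open>l j\<close> is a hyperplane of \<open>V\<close>, since the subspaces
  \<open>H + l j\<close> cover \<open>V\<close>; it meets every \<open>A j\<close>, so some transversal does not span \<open>V\<close>.\<close>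

lemma exists_flat_with_direction_in:
  assumes J: "finite J" "infinite (UNIV :: 'a set) \<or> card J < card (UNIV :: 'a set)"
    and A: "\<And>j. j \<in> J \<Longrightarrow> flat (A j)" "\<And>j. j \<in> J \<Longrightarrow> A j \<subseteq> V"
    and K: "subspace K" "subspace V" "K \<subset> V" "V \<subseteq> E"
    and spanning: "\<And>a. (\<And>j. j \<in> J \<Longrightarrow> a j \<in> A j) \<Longrightarrow> V \<subseteq> span (K \<union> a ` J)"
  shows "\<exists>j\<in>J. direction (A j) \<subseteq> K \<and> \<not> A j \<subseteq> K"
proof (rule ccontr)
  assume neg: "\<not> ?thesis"
  define J' where "J' = {j \<in> J. \<not> direction (A j) \<subseteq> K}"
  have "\<forall>j\<in>J'. \<exists>l. l \<in> direction (A j) - K" by (auto simp: J'_def)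
  then obtain l where l: "\<And>j. j \<in> J' \<Longrightarrow> l j \<in> direction (A j)" "\<And>j. j \<in> J' \<Longrightarrow> l j \<notin> K"
    by (metis Diff_iff)
  have lV: "l j \<in> V" if "j \<in> J'" for j
    using that l(1) direction_subset_subspace[OF K(2)] A(2) J'_def by blast
  have rest: "A j \<subseteq> K" if "j \<in> J - J'" for j using that neg by (auto simp: J'_def)
  obtain b where b: "\<And>j. j \<in> J \<Longrightarrow> b j \<in> A j" 
  proof -
    have "\<forall>j\<in>J. \<exists>x. x \<in> A j" using A(1) unfolding flat_def by blast
    then show thesis using that by metis
  qed
  obtain H where H: "K \<subseteq> H \<and> (\<forall>j\<in>J'. l j \<notin> H)" "subspace H" "H \<subseteq> V"
    "\<And>x. x \<in> V \<Longrightarrow> K \<subseteq> span (insert x H) \<and> (\<forall>j\<in>J'. l j \<notin> span (insert x H)) \<Longrightarrow> x \<in> H"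
    by (rule exists_maximal_subspace[of "\<lambda>H. K \<subseteq> H \<and> (\<forall>j\<in>J'. l j \<notin> H)" K V])
      (use l(2) K in auto)
  have spanH: "span H = H" using H(2) by (simp add: span_eq_iff)
  have capture: "\<exists>j\<in>J'. x \<in> span (insert (l j) H)" if x: "x \<in> V" "x \<notin> H" for x
  proof -
    have "K \<subseteq> span (insert x H)" using H(1) span_superset[of "insert x H"] by blast
    then obtain j where j: "j \<in> J'" "l j \<in> span (insert x H)" using H(4) x by blast
    then have "x \<in> span (insert (l j) H)" using in_span_insert H(1) spanH by blast
    then show ?thesis using j(1) by blast
  qed
  have "H \<noteq> V"
  proof
    assume "H = V"
    then have "J' = {}" using lV H(1) by blast
    then have "b ` J \<subseteq> K" using rest b by blast
    then have "span (K \<union> b ` J) \<subseteq> K" using K(1) by (intro span_minimal) auto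
    then show False using spanning[of b] b K(3) by blast
  qed
  then obtain x where x: "x \<in> V" "x \<notin> H" using H(3) by blast
  have "\<exists>j\<in>J'. V \<subseteq> span (insert (l j) H)"
  proof (rule flat_subset_of_cover)
    show "finite J'" using J(1) by (simp add: J'_def)
    have "card J' \<le> card J" using J(1) by (intro card_mono) (auto simp: J'_def)
    then show "infinite (UNIV :: 'a set) \<or> card J' < card (UNIV :: 'a set)" using J(2) by auto
    show "flat V" using K(2) by (rule flat_subspace)
    show "subspace (span (insert (l j) H))" for j by simp
    show "V \<subseteq> (\<Union>j\<in>J'. span (insert (l j) H))"
    proof
      fix y assume y: "y \<in> V"
      show "y \<in> (\<Union>j\<in>J'. span (insert (l j) H))"
      proof (cases "y \<in> H")
        case True
        then show ?thesis using capture[OF x] by (auto intro: span_base)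
      qed (use capture y in blast)
    qed
  qed
  then obtain j0 where j0: "j0 \<in> J'" "V \<subseteq> span (insert (l j0) H)" by blast
  \<comment> \<open>Over the hyperplane \<open>H\<close> each \<open>l j\<close> generates
    \<open>V\<close>, so any point of \<open>A j\<close> can be moved along \<open>l j\<close> into
    \<open>H\<close>; the remaining flats lie in \<open>K\<close> already.\<close>
  have "\<exists>y. y \<in> A j \<inter> H" if j: "j \<in> J" for j
  proof (cases "j \<in> J'")
    case True
    have "l j \<in> span (insert (l j0) H)" using lV[OF True] j0(2) by blast
    then have "l j0 \<in> span (insert (l j) H)" using in_span_insert H(1) spanH True by metis
    moreover have "H \<subseteq> span (insert (l j) H)" using span_superset by blast
    ultimately have "span (insert (l j0) H) \<subseteq> span (insert (l j) H)"
      by (intro span_minimal) auto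
    then have "b j \<in> span (insert (l j) H)" using b A(2) j j0(2) by blast
    then obtain k where "b j - scale k (l j) \<in> H" using span_breakdown_eq spanH by blast
    moreover have "b j + scale (- k) (l j) \<in> A j"
      using flat_add_direction A(1) b j l(1)[OF True] by blast
    ultimately show ?thesis by auto
  qed (use b rest j H(1) in blast)
  then obtain a where a: "\<And>j. j \<in> J \<Longrightarrow> a j \<in> A j \<inter> H" by metis
  have "span (K \<union> a ` J) \<subseteq> H" using a H(1,2) by (intro span_minimal) auto
  moreover have "V \<subseteq> span (K \<union> a ` J)" using a by (intro spanning) auto
  ultimately show False using \<open>H \<noteq> V\<close> H(3) by blast
qed

text \<open>Peeling goes from the front. A column with all its directions in \<open>K\<close> lies
  in one coset of \<open>K\<close>, gives the next pivot, and is absorbed into \<open>K\<close>. The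
  induction is on \<open>dim V - dim K\<close>, so some columns may be left over when
  \<open>V\<close> is exhausted.\<close>

lemma spanning_flats_flag:
  assumes "finite J" "infinite (UNIV :: 'a set) \<or> card J < card (UNIV :: 'a set)"
    and "\<And>j. j \<in> J \<Longrightarrow> flat (A j)" "\<And>j. j \<in> J \<Longrightarrow> A j \<subseteq> V"
    and "subspace K" "subspace V" "K \<subseteq> V" "V \<subseteq> E"
    and "\<And>a. (\<And>j. j \<in> J \<Longrightarrow> a j \<in> A j) \<Longrightarrow> V \<subseteq> span (K \<union> a ` J)"
  shows "\<exists>bs js. set js \<subseteq> J \<and> distinct js \<and> length js = length bs \<and>
    dim V = dim K + length bs \<and> span (K \<union> set bs) = V \<and>
    (\<forall>k<length js. \<forall>y\<in>A (js ! k). y - bs ! k \<in> span (K \<union> set (take k bs)))"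
  using assms
proof (induction "dim V - dim K" arbitrary: J K)
  case 0
  have "dim V \<le> dim K" using 0(1) by simp
  then have "K = V" using 0(6-9) by (intro subspace_eq_of_dim_le) auto
  then show ?case using 0(6) by (intro exI[of _ "[]"]) (auto simp: span_eq_iff[THEN iffD2])
next
  case (Suc r)
  have "K \<noteq> V" using Suc.hyps(2) by auto
  then have "\<exists>j\<in>J. direction (A j) \<subseteq> K \<and> \<not> A j \<subseteq> K"
    using Suc.prems by (intro exists_flat_with_direction_in[of J A V K]) auto
  then obtain j a where j: "j \<in> J" "direction (A j) \<subseteq> K" and a: "a \<in> A j" "a \<notin> K" by blast
  have aV: "a \<in> V" using a j Suc.prems(4) by blast
  define K' where "K' = span (insert a K)"
  have "a \<notin> span K" using a(2) Suc.prems(5) by (metis span_eq_iff)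
  then have "dim (insert a K) = Suc (dim K)"
    using aV Suc.prems(7,8) by (intro dim_insert_notin) auto
  then have dK': "dim K' = Suc (dim K)" by (simp add: K'_def)
  have "\<exists>bs js. set js \<subseteq> J - {j} \<and> distinct js \<and> length js = length bs \<and>
    dim V = dim K' + length bs \<and> span (K' \<union> set bs) = V \<and>
    (\<forall>k<length js. \<forall>y\<in>A (js ! k). y - bs ! k \<in> span (K' \<union> set (take k bs)))"
  proof (rule Suc.hyps(1))
    show "r = dim V - dim K'" using Suc.hyps(2) dK' by simp
    show "infinite (UNIV :: 'a set) \<or> card (J - {j}) < card (UNIV :: 'a set)"
      using Suc.prems(1,2) card_Diff1_le[of J j] by linarith
    show "K' \<subseteq> V" unfolding K'_def using aV Suc.prems(6,7) by (intro span_minimal) auto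
    show "V \<subseteq> span (K' \<union> b ` (J - {j}))" if b: "\<And>i. i \<in> J - {j} \<Longrightarrow> b i \<in> A i" for b
    proof -
      have "V \<subseteq> span (K \<union> (b(j := a)) ` J)" using b a by (intro Suc.prems(9)) auto
      also have "\<dots> \<subseteq> span (K' \<union> b ` (J - {j}))"
        using span_superset[of "insert a K"] by (intro span_mono) (auto simp: K'_def)
      finally show ?thesis .
    qed
  qed (use Suc.prems in \<open>auto simp: K'_def\<close>)
  then obtain bs js where IH: "set js \<subseteq> J - {j}" "distinct js" "length js = length bs"
    "dim V = dim K' + length bs" "span (K' \<union> set bs) = V"
    "\<And>k y. k < length js \<Longrightarrow> y \<in> A (js ! k) \<Longrightarrow> y - bs ! k \<in> span (K' \<union> set (take k bs))"
    by blast
  have spanK': "span (K' \<union> X) = span (K \<union> insert a X)" for X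
  proof (rule span_eq[THEN iffD2], intro conjI)
    have "K' \<subseteq> span (K \<union> insert a X)" unfolding K'_def by (rule span_mono) auto
    then show "K' \<union> X \<subseteq> span (K \<union> insert a X)" by (auto intro: span_base)
    have "insert a K \<subseteq> K'" unfolding K'_def by (rule span_superset)
    then show "K \<union> insert a X \<subseteq> span (K' \<union> X)" by (auto intro: span_base)
  qed
  have "y - (a # bs) ! k \<in> span (K \<union> set (take k (a # bs)))"
    if k: "k < length (j # js)" and y: "y \<in> A ((j # js) ! k)" for k y
  proof (cases k)
    case 0
    then show ?thesis using y j(2) diff_in_direction[OF a(1)] span_base by auto
  next
    case (Suc k')
    then show ?thesis using IH(6)[of k' y] k y by (simp add: spanK')
  qed
  then show ?case
    using IH(1-5) j(1) dK' spanK'[of "set bs"]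
    by (intro exI[of _ "a # bs"] exI[of _ "j # js"]) auto
qed

subsection \<open>Adapted flags\<close>

lemma span_span_Un: "span (span X \<union> Y) = span (X \<union> Y)"
proof (rule span_eq[THEN iffD2], intro conjI)
  have "span X \<subseteq> span (X \<union> Y)" by (rule span_mono) auto
  then show "span X \<union> Y \<subseteq> span (X \<union> Y)" by (auto intro: span_base)
  show "X \<union> Y \<subseteq> span (span X \<union> Y)" by (auto intro: span_base)
qed

lemma dim_trivial: "dim {} = 0" "dim {0} = 0"
  using dim_le_card'[of "{}"] dim_span[of "{}"] by simp_all

section \<open>Minimizers under constant rank and the construction of a flag form\<close>

lemma ex_transversal:
  assumes "\<And>j. j \<in> J \<Longrightarrow> A j \<noteq> {}"
  shows "\<exists>a. \<forall>j\<in>J. a j \<in> A j"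
  using assms by (intro bchoice) blast

lemma indep_mod_subset:
  assumes "indep_mod K a J" "I \<subseteq> J"
  shows "indep_mod K a I"
  unfolding indep_mod_def
proof
  fix j assume j: "j \<in> I"
  have "span (K \<union> a ` (I - {j})) \<subseteq> span (K \<union> a ` (J - {j}))"
    using assms(2) by (intro span_mono) auto
  then show "a j \<notin> span (K \<union> a ` (I - {j}))"
    using assms j unfolding indep_mod_def by blast
qed

text \<open>By \<open>rado_transversal\<close> some transversal reaches
  \<open>rank_bound A J V\<close>, hence by constancy all do, and the estimate behind
  \<open>rank_le_rank_bound\<close> is tight for each: the inside columns contribute the full
  \<open>dim V\<close>, and no outside column is redundant modulo \<open>V\<close>.\<close>

lemma minimizer_of_constant_rank:
  assumes J: "finite J" and A: "\<And>j. j \<in> J \<Longrightarrow> A j \<noteq> {}" "\<And>j. j \<in> J \<Longrightarrow> A j \<subseteq> E"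
    and rank: "\<And>a. (\<And>j. j \<in> J \<Longrightarrow> a j \<in> A j) \<Longrightarrow> dim (a ` J) = \<rho>"
    and V: "minimizer A J V"
  shows "rank_bound A J V = \<rho>"
    and "\<And>a. (\<And>j. j \<in> J \<Longrightarrow> a j \<in> A j) \<Longrightarrow> V \<subseteq> span (a ` {j \<in> J. A j \<subseteq> V})"
    and "\<And>a. (\<And>j. j \<in> J \<Longrightarrow> a j \<in> A j) \<Longrightarrow> indep_mod V a {j \<in> J. \<not> A j \<subseteq> V}"
proof -
  have sub: "subspace V" "V \<subseteq> E" using V by (auto simp: minimizer_def)
  obtain a where a: "\<And>j. j \<in> J \<Longrightarrow> a j \<in> A j" "rank_bound A J V \<le> dim (a ` J)"
    by (rule rado_transversal[OF J A, where \<rho> = "rank_bound A J V"])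
      (use V in \<open>auto simp: minimizer_def\<close>)
  show rb: "rank_bound A J V = \<rho>"
    using a rank[of a] rank_le_rank_bound[where a = a and A = A, OF J a(1) A(2) sub] by simp
  fix a assume a: "\<And>j. j \<in> J \<Longrightarrow> a j \<in> A j"
  let ?I = "{j \<in> J. A j \<subseteq> V}" and ?O = "{j \<in> J. \<not> A j \<subseteq> V}"
  have aE: "a ` J \<subseteq> E" using a A(2) by blast
  have \<rho>: "\<rho> = dim V + card ?O" using rb by (simp add: rank_bound_def)
  have split: "a ` J = a ` ?I \<union> a ` ?O" by blast
  have "dim (a ` J) \<le> dim (a ` ?I) + card (a ` ?O)"
    unfolding split using J aE by (intro dim_Un_le) auto
  also have "\<dots> \<le> dim (a ` ?I) + card ?O" using J by (simp add: card_image_le)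
  finally have "dim V \<le> dim (span (a ` ?I))" using \<rho> rank[of a] a by simp
  moreover have "span (a ` ?I) \<subseteq> V" using a sub(1) by (intro span_minimal) auto
  ultimately have "span (a ` ?I) = V" using sub(2) by (intro subspace_eq_of_dim_le) auto
  then show "V \<subseteq> span (a ` ?I)" by simp
  show "indep_mod V a ?O"
    unfolding indep_mod_def
  proof
    fix j assume j: "j \<in> ?O"
    show "a j \<notin> span (V \<union> a ` (?O - {j}))"
    proof
      assume aj: "a j \<in> span (V \<union> a ` (?O - {j}))"
      have VE: "V \<union> a ` (?O - {j}) \<subseteq> E" using sub(2) aE by blast
      have "a i \<in> span (V \<union> a ` (?O - {j}))" if i: "i \<in> J" for i
      proof (cases "i = j")
        case False
        then have "a i \<in> V \<union> a ` (?O - {j})" using a i by auto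
        then show ?thesis by (rule span_base)
      qed (use aj in simp)
      then have "dim (a ` J) \<le> dim (V \<union> a ` (?O - {j}))"
        using VE by (intro dim_le_of_subset_span) auto
      also have "\<dots> \<le> dim V + card (a ` (?O - {j}))"
        using J VE by (intro dim_Un_le) auto
      also have "\<dots> \<le> dim V + card (?O - {j})" using J by (simp add: card_image_le)
      also have "\<dots> < dim V + card ?O" using j J by (intro add_strict_left_mono card_Diff1_less) auto
      finally show False using \<rho> rank[of a] a by simp
    qed
  qed
qed

text \<open>The coordinate-free content of the block form: \<open>bs\<close> is an adapted basis of the column space
  (the columns of the inverse of \<open>R\<close>), \<open>js\<close> is the order of the columns (the permutation \<open>Q\<close>),
  and a unit pivot with zeros below it says that a column lies in a translate of the span of the
  preceding basis vectors.\<close>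

abbreviation flag :: "'b list \<Rightarrow> nat \<Rightarrow> 'b set" where
  "flag bs i \<equiv> span (set (take i bs))"

definition pivot :: "'b list \<Rightarrow> nat \<Rightarrow> 'b set \<Rightarrow> bool" where
  "pivot bs k X \<longleftrightarrow> (\<forall>y\<in>X. y - bs ! k \<in> flag bs k)"

definition flag_form :: "('i \<Rightarrow> 'b set) \<Rightarrow> 'i set \<Rightarrow> 'b list \<Rightarrow> 'i list \<Rightarrow>
    nat \<Rightarrow> nat \<Rightarrow> nat \<Rightarrow> nat \<Rightarrow> nat \<Rightarrow> bool" where
  "flag_form A J bs js r1 c1 s r3 c3 \<longleftrightarrow>
     set js = J \<and> distinct js \<and> span (set bs) = E \<and> length bs = dim E \<and>
     r1 + s + r3 = length bs \<and> c1 + s + c3 = length js \<and>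
     (\<forall>k<c1. A (js ! k) \<subseteq> flag bs r1) \<and> (\<forall>k<c1 + s. A (js ! k) \<subseteq> flag bs (r1 + s)) \<and>
     (r1 = 0 \<or> r1 < c1 \<and> (\<forall>k<r1. pivot bs k (A (js ! k)))) \<and>
     (\<forall>k<s. pivot bs (r1 + k) (A (js ! (c1 + k)))) \<and>
     (c3 = 0 \<or> c3 < r3 \<and> (\<forall>k<c3. pivot bs (r1 + s + (r3 - c3) + k) (A (js ! (c1 + s + k)))))"

text \<open>The columns are sorted by whether they lie in \<open>V\<close>, in \<open>W\<close> but
  not in \<open>V\<close>, or outside \<open>W\<close>. Peeling from the front treats the first
  group over the zero space, peeling from the back treats the other two over \<open>V\<close> and
  over \<open>W\<close>, and the three partial bases are concatenated.\<close>

lemma flag_form_of_constant_rank: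
  assumes J: "finite J" "infinite (UNIV :: 'a set) \<or> card J < card (UNIV :: 'a set)"
    and A: "\<And>j. j \<in> J \<Longrightarrow> flat (A j)" "\<And>j. j \<in> J \<Longrightarrow> A j \<subseteq> E"
    and rank: "\<And>a. (\<And>j. j \<in> J \<Longrightarrow> a j \<in> A j) \<Longrightarrow> dim (a ` J) = \<rho>"
    and V: "minimizer A J V" "\<And>U. minimizer A J U \<Longrightarrow> V \<subseteq> U"
    and W: "minimizer A J W" "\<And>U. minimizer A J U \<Longrightarrow> U \<subseteq> W"
  shows "\<exists>bs js c1 s r3 c3. flag_form A J bs js (dim V) c1 s r3 c3 \<and> dim W = dim V + s"
proof -
  have A0: "\<And>j. j \<in> J \<Longrightarrow> A j \<noteq> {}" using A(1) by (auto simp: flat_def)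
  have subV: "subspace V" "V \<subseteq> E" and subW: "subspace W" "W \<subseteq> E"
    using V W by (auto simp: minimizer_def)
  have VW: "V \<subseteq> W" using V(2) W(1) by blast
  note mV = minimizer_of_constant_rank[OF J(1) A0 A(2) rank V(1)]
  note mW = minimizer_of_constant_rank[OF J(1) A0 A(2) rank W(1)]
  define JV where "JV = {j \<in> J. A j \<subseteq> V}"
  define JS where "JS = {j \<in> J. A j \<subseteq> W \<and> \<not> A j \<subseteq> V}"
  define JT where "JT = {j \<in> J. \<not> A j \<subseteq> W}"
  have fin: "finite JV" "finite JS" "finite JT" using J(1) by (auto simp: JV_def JS_def JT_def)
  have part: "J = JV \<union> JS \<union> JT" "JV \<inter> JS = {}" "JV \<inter> JT = {}" "JS \<inter> JT = {}"
    using VW by (auto simp: JV_def JS_def JT_def)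
  have outV: "{j \<in> J. \<not> A j \<subseteq> V} = JS \<union> JT" using VW by (auto simp: JS_def JT_def)
  have cards: "card JV \<le> card J" "card JS \<le> card J" "card JT \<le> card J"
    using J(1) by (auto intro!: card_mono simp: JV_def JS_def JT_def)
  have cJ: "card J = card JV + card JS + card JT"
    using fin part by (simp add: card_Un_disjoint Int_Un_distrib2)
  have cV: "\<rho> = dim V + card JS + card JT"
    using mV(1) outV fin part(4) by (simp add: rank_bound_def card_Un_disjoint)
  have cW: "\<rho> = dim W + card JT" using mW(1) by (simp add: rank_bound_def JT_def)
  \<comment> \<open>Both minimizers have the bound \<open>\<rho>\<close>; the difference of the two
    formulas gives as many dimensions as columns between them, so \<open>S\<close> is
    square.\<close>
  have dW: "dim W = dim V + card JS" using cV cW by simp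
  \<comment> \<open>The facts about minimizers speak of full transversals, so a choice on one group
    of columns is completed arbitrarily.\<close>
  have extend: "\<exists>b. (\<forall>j\<in>J. b j \<in> A j) \<and> (\<forall>j\<in>I. b j = a j)"
    if "\<And>j. j \<in> I \<Longrightarrow> a j \<in> A j" for I a
  proof -
    let ?b = "\<lambda>j. if j \<in> I then a j else SOME y. y \<in> A j"
    have "\<forall>j\<in>J. ?b j \<in> A j" using that A0 by (auto simp: some_in_eq)
    then show ?thesis by (intro exI[of _ ?b]) auto
  qed
  have spanJV: "V \<subseteq> span ({0} \<union> a ` JV)" if a: "\<And>j. j \<in> JV \<Longrightarrow> a j \<in> A j" for a
  proof -
    obtain b where b: "\<forall>j\<in>J. b j \<in> A j" "\<forall>j\<in>JV. b j = a j" using extend[of JV a] a by blast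
    have "b ` JV = a ` JV" using b(2) by auto
    then show ?thesis using mV(2)[of b] b(1) unfolding JV_def[symmetric] by simp
  qed
  have cong: "indep_mod K a I = indep_mod K b I" if "\<forall>j\<in>I. b j = a j" for K I and a b :: "'c \<Rightarrow> 'b"
  proof -
    have "b ` (I - {j}) = a ` (I - {j})" for j using that by auto
    then show ?thesis using that by (simp add: indep_mod_def)
  qed
  have indJS: "indep_mod V a JS" if a: "\<And>j. j \<in> JS \<Longrightarrow> a j \<in> A j" for a
  proof -
    obtain b where b: "\<forall>j\<in>J. b j \<in> A j" "\<forall>j\<in>JS. b j = a j" using extend[of JS a] a by blast
    have "indep_mod V b (JS \<union> JT)" using mV(3)[of b] b(1) unfolding outV by blast
    then show ?thesis using indep_mod_subset[of V b _ JS] cong[OF b(2)] by blast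
  qed
  have indJT: "indep_mod W a JT" if a: "\<And>j. j \<in> JT \<Longrightarrow> a j \<in> A j" for a
  proof -
    obtain b where b: "\<forall>j\<in>J. b j \<in> A j" "\<forall>j\<in>JT. b j = a j" using extend[of JT a] a by blast
    have "indep_mod W b JT" using mW(3)[of b] b(1) unfolding JT_def by blast
    then show ?thesis using cong[OF b(2)] by blast
  qed
  have "\<exists>bs js. set js \<subseteq> JV \<and> distinct js \<and> length js = length bs \<and>
    dim V = dim {0} + length bs \<and> span ({0} \<union> set bs) = V \<and>
    (\<forall>k<length js. \<forall>y\<in>A (js ! k). y - bs ! k \<in> span ({0} \<union> set (take k bs)))"
    by (rule spanning_flats_flag)
      (use fin(1) J(2) cards(1) A(1) subV spanJV in \<open>auto simp: JV_def subspace_0\<close>)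
  then obtain b1 j1 where 1: "set j1 \<subseteq> JV" "distinct j1" "length j1 = length b1"
    "dim V = length b1" "span (set b1) = V" "\<And>k. k < length j1 \<Longrightarrow> pivot b1 k (A (j1 ! k))"
    by (auto simp: pivot_def dim_trivial)
  have "\<exists>bs js. set js = JS \<and> distinct js \<and> length js \<le> length bs \<and>
    dim W = dim V + length bs \<and> span (V \<union> set bs) = W \<and>
    (\<forall>k<length js. \<forall>y\<in>A (js ! k). y - bs ! (length bs - length js + k)
       \<in> span (V \<union> set (take (length bs - length js + k) bs)))"
    by (rule independent_flats_flag)
      (use fin(2) J(2) cards(2) A(1) subV subW VW indJS in \<open>auto simp: JS_def\<close>)
  then obtain b2 j2 where 2: "set j2 = JS" "distinct j2" "dim W = dim V + length b2"
    "span (V \<union> set b2) = W"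
    "\<And>k y. k < length j2 \<Longrightarrow> y \<in> A (j2 ! k) \<Longrightarrow> y - b2 ! (length b2 - length j2 + k)
       \<in> span (V \<union> set (take (length b2 - length j2 + k) b2))" by blast
  have "\<exists>bs js. set js = JT \<and> distinct js \<and> length js \<le> length bs \<and>
    dim E = dim W + length bs \<and> span (W \<union> set bs) = E \<and>
    (\<forall>k<length js. \<forall>y\<in>A (js ! k). y - bs ! (length bs - length js + k)
       \<in> span (W \<union> set (take (length bs - length js + k) bs)))"
    by (rule independent_flats_flag)
      (use fin(3) J(2) cards(3) A subW subspace_E indJT in \<open>auto simp: JT_def\<close>)
  then obtain b3 j3 where 3: "set j3 = JT" "distinct j3" "length j3 \<le> length b3"
    "dim E = dim W + length b3" "span (W \<union> set b3) = E"
    "\<And>k y. k < length j3 \<Longrightarrow> y \<in> A (j3 ! k) \<Longrightarrow> y - b3 ! (length b3 - length j3 + k)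
       \<in> span (W \<union> set (take (length b3 - length j3 + k) b3))" by blast
  \<comment> \<open>The columns inside \<open>V\<close> that received no pivot; they form the
    arbitrary right part of \<open>W\<close>.\<close>
  obtain j1' where j1': "set j1' = JV - set j1" "distinct j1'"
    using finite_distinct_list fin(1) by (metis finite_Diff)
  define bs where "bs = b1 @ b2 @ b3"
  define js where "js = (j1 @ j1') @ j2 @ j3"
  have len: "length j2 = card JS" "length j3 = card JT" "length (j1 @ j1') = card JV"
    using 2(1,2) 3(1,2) 1(1,2) j1' distinct_card[of j2] distinct_card[of j3]
      distinct_card[of "j1 @ j1'"] by (auto simp: Un_absorb1)
  have len2: "length j2 = length b2" using 2(3) dW len by simp
  have Vspan: "span (V \<union> X) = span (set b1 \<union> X)" for X using span_span_Un 1(5) by metis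
  have W_eq: "span (set b1 \<union> set b2) = W" using 2(4) Vspan by simp
  have Wspan: "span (W \<union> X) = span (set b1 \<union> set b2 \<union> X)" for X using span_span_Un W_eq by metis
  have flV: "flag bs (dim V) = V" using 1(4,5) by (simp add: bs_def)
  have flW: "flag bs (dim V + length b2) = W" using 1(4) W_eq by (simp add: bs_def)
  have "flag_form A J bs js (dim V) (card JV) (length b2) (length b3) (length j3)"
    unfolding flag_form_def flV flW
  proof (intro conjI)
    show "set js = J" unfolding js_def using 1(1) j1'(1) 2(1) 3(1) part(1) by auto
    show "distinct js" unfolding js_def using 1(1,2) j1' 2(1,2) 3(1,2) part by auto
    show "span (set bs) = E" using 3(5) Wspan[of "set b3"] by (simp add: bs_def Un_assoc)
    show "length bs = dim E" using 3(4) 2(3) 1(4) by (simp add: bs_def)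
    show "dim V + length b2 + length b3 = length bs" using 1(4) by (simp add: bs_def)
    show "card JV + length b2 + length j3 = length js" using len len2 by (simp add: js_def)
    show "\<forall>k<card JV. A (js ! k) \<subseteq> V"
    proof (intro allI impI)
      fix k assume k: "k < card JV"
      then have "js ! k = (j1 @ j1') ! k" unfolding js_def using len(3) by (metis nth_append)
      then have "js ! k \<in> set (j1 @ j1')" using k len(3) nth_mem by metis
      then have "js ! k \<in> JV" using 1(1) j1' by auto
      then show "A (js ! k) \<subseteq> V" by (simp add: JV_def)
    qed
    show "\<forall>k<card JV + length b2. A (js ! k) \<subseteq> W"
    proof (intro allI impI)
      fix k assume k: "k < card JV + length b2"
      have k': "k < length ((j1 @ j1') @ j2)" using k len len2 by simp
      have "js = ((j1 @ j1') @ j2) @ j3" by (simp add: js_def)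
      then have "js ! k = ((j1 @ j1') @ j2) ! k" using k' by (metis nth_append)
      then have "js ! k \<in> set ((j1 @ j1') @ j2)" using k' nth_mem by metis
      then have "js ! k \<in> JV \<union> JS" using 1(1) j1' 2(1) by auto
      then show "A (js ! k) \<subseteq> W" using VW by (auto simp: JV_def JS_def)
    qed
    show "dim V = 0 \<or> dim V < card JV \<and> (\<forall>k<dim V. pivot bs k (A (js ! k)))"
    proof (cases "dim V = 0")
      case False
      \<comment> \<open>The bound at the zero space is at most the number of columns and exceeds
        that at \<open>V\<close>. Cancelling the columns outside \<open>V\<close> leaves
        \<open>dim V\<close> smaller than the number of columns inside.\<close>
      have "\<not> minimizer A J {0}"
      proof
        assume "minimizer A J {0}"
        then have "V \<subseteq> {0}" using V(2) by blast
        then have "V = {0}" using subV(1) subspace_0 by blast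
        then show False using False dim_trivial by auto
      qed
      then have "rank_bound A J V < rank_bound A J {0}"
        using V(1) subspace_0[OF subspace_E] unfolding minimizer_def
        by (metis empty_subsetI insert_subset le_trans not_le subspace_single_0)
      also have "\<dots> \<le> card J"
        using J(1) by (auto simp: rank_bound_def dim_trivial intro: card_mono)
      finally have "dim V < card JV" using mV(1) cV cJ by simp
      moreover have "pivot bs k (A (js ! k))" if "k < dim V" for k
        using 1(6)[of k] 1(3,4) that by (simp add: pivot_def bs_def js_def nth_append)
      ultimately show ?thesis by blast
    qed simp
    show "\<forall>k<length b2. pivot bs (dim V + k) (A (js ! (card JV + k)))"
    proof (intro allI impI)
      fix k assume k: "k < length b2"
      have "js ! (card JV + k) = j2 ! k" unfolding js_def len(3)[symmetric] nth_append_length_plus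
        using k len2 by (simp add: nth_append)
      moreover have "bs ! (dim V + k) = b2 ! k" unfolding bs_def 1(4) nth_append_length_plus
        using k by (simp add: nth_append)
      moreover have "flag bs (dim V + k) = span (V \<union> set (take k b2))"
        unfolding Vspan using k by (simp add: bs_def 1(4))
      ultimately show "pivot bs (dim V + k) (A (js ! (card JV + k)))"
        using 2(5)[of k] k len2 by (simp add: pivot_def)
    qed
    show "length j3 = 0 \<or> length j3 < length b3 \<and>
      (\<forall>k<length j3. pivot bs (dim V + length b2 + (length b3 - length j3) + k)
         (A (js ! (card JV + length b2 + k))))"
    proof (cases "W = E")
      case True
      then have "JT = {}" using A(2) by (auto simp: JT_def)
      then show ?thesis using len by simp
    next
      case False
      \<comment> \<open>The bound at \<open>E\<close> is \<open>dim E\<close> and exceeds that at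
        \<open>W\<close>, so there are fewer columns outside \<open>W\<close> than dimensions above
        it.\<close>
      have "\<not> minimizer A J E" using W(2)[of E] subW(2) False by auto
      then have "rank_bound A J W < rank_bound A J E"
        using W(1) subspace_E unfolding minimizer_def by (metis le_trans not_le order_refl)
      also have "{j \<in> J. \<not> A j \<subseteq> E} = {}" using A(2) by blast
      then have "rank_bound A J E = dim E" by (simp add: rank_bound_def del: Collect_empty_eq)
      finally have "length j3 < length b3" using mW(1) cW len(2) 3(4) by simp
      moreover have "pivot bs (dim V + length b2 + (length b3 - length j3) + k)
         (A (js ! (card JV + length b2 + k)))" if k: "k < length j3" for k
      proof -
        let ?t = "length b3 - length j3 + k"
        have t: "?t < length b3" using k 3(3) by simp
        have i: "dim V + length b2 + (length b3 - length j3) + k = length (b1 @ b2) + ?t"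
          using 1(4) by simp
        have bs: "bs = (b1 @ b2) @ b3" by (simp add: bs_def)
        have js: "js = (j1 @ j1' @ j2) @ j3" by (simp add: js_def)
        have c: "card JV + length b2 + k = length (j1 @ j1' @ j2) + k" using len len2 by simp
        have "js ! (card JV + length b2 + k) = j3 ! k"
          unfolding js c nth_append_length_plus ..
        moreover have "bs ! (length (b1 @ b2) + ?t) = b3 ! ?t"
          unfolding bs nth_append_length_plus ..
        moreover have "flag bs (length (b1 @ b2) + ?t) = span (W \<union> set (take ?t b3))"
          unfolding Wspan bs by (simp add: Un_assoc del: Nat.add_diff_assoc Nat.add_diff_assoc2)
        ultimately show ?thesis unfolding i pivot_def
          using 3(6)[of k] k by (simp del: Nat.add_diff_assoc Nat.add_diff_assoc2)
      qed
      ultimately show ?thesis by blast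
    qed
  qed
  then show ?thesis using 2(3) by blast
qed

section \<open>Ranks, minimizers and column sets read off a flag form\<close>

lemma flag_mono: "i \<le> j \<Longrightarrow> flag bs i \<subseteq> flag bs j"
  by (intro span_mono set_take_subset_set_take)

text \<open>The first \<open>i\<close> vectors span at most \<open>i\<close> dimensions and the
  others add at most \<open>length bs - i\<close>; as the total is \<open>dim E\<close>, neither
  estimate has slack.\<close>

lemma dim_flag:
  assumes "span (set bs) = E" "length bs = dim E" "i \<le> length bs"
  shows "dim (flag bs i) = i"
proof (rule order_antisym)
  have bE: "set bs \<subseteq> E" using assms(1) span_superset by blast
  then have tE: "set (take i bs) \<subseteq> E" "set (drop i bs) \<subseteq> E"
    using set_take_subset set_drop_subset by (metis subset_trans)+
  have "card (set (take i bs)) \<le> i" using card_length[of "take i bs"] assms(3) by simp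
  then show "dim (flag bs i) \<le> i"
    using dim_le_card'[of "set (take i bs)"] by simp
  have "set bs = set (take i bs) \<union> set (drop i bs)"
    by (metis append_take_drop_id set_append)
  then have "dim (set bs) \<le> dim (set (take i bs)) + card (set (drop i bs))"
    using dim_Un_le[OF _ tE] by simp
  also have "\<dots> \<le> dim (flag bs i) + (length bs - i)"
    using card_length[of "drop i bs"] by simp
  finally show "i \<le> dim (flag bs i)" using assms dim_span[of "set bs"] by simp
qed

lemma basis_notin_flag:
  assumes "span (set bs) = E" "length bs = dim E" "i < length bs"
  shows "bs ! i \<notin> flag bs i"
proof
  assume "bs ! i \<in> flag bs i"
  then have "span (insert (bs ! i) (set (take i bs))) = flag bs i" by (rule span_redundant)
  then have "flag bs (Suc i) = flag bs i" using assms(3) by (simp add: take_Suc_conv_app_nth)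
  then show False using dim_flag[OF assms(1,2), of i] dim_flag[OF assms(1,2), of "Suc i"] assms(3)
    by simp
qed

text \<open>Each \<open>v k\<close> lies outside the flag that contains everything before it and so
  adds one dimension. \<open>X\<close> may have dimension below \<open>t\<close>: the upper rows of
  \<open>T\<close> carry no pivots and are skipped.\<close>

lemma dim_pivots:
  assumes b: "span (set bs) = E" "length bs = dim E"
    and "X \<subseteq> flag bs t" "t + c \<le> length bs"
    and "\<And>k. k < c \<Longrightarrow> v k - bs ! (t + k) \<in> flag bs (t + k)"
  shows "dim (X \<union> v ` {..<c}) = dim X + c \<and> X \<union> v ` {..<c} \<subseteq> flag bs (t + c)"
  using assms(4,5)
proof (induction c)
  case 0
  then show ?case using assms(3) by simp
next
  case (Suc c)
  then have IH: "dim (X \<union> v ` {..<c}) = dim X + c" "X \<union> v ` {..<c} \<subseteq> flag bs (t + c)" by auto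
  have bE: "set bs \<subseteq> E" using b(1) span_superset by blast
  have flE: "flag bs i \<subseteq> E" for i
    using bE set_take_subset span_subset_E by (metis subset_trans)
  have d: "v c - bs ! (t + c) \<in> flag bs (t + c)" using Suc.prems by simp
  have tc: "t + c < length bs" using Suc.prems by simp
  have "v c \<notin> flag bs (t + c)"
  proof
    assume "v c \<in> flag bs (t + c)"
    then have "v c - (v c - bs ! (t + c)) \<in> flag bs (t + c)" using d span_diff by blast
    then show False using basis_notin_flag[OF b tc] by simp
  qed
  then have vc: "v c \<notin> span (X \<union> v ` {..<c})"
    using span_minimal[OF IH(2) subspace_span] by blast
  have "bs ! (t + c) \<in> flag bs (t + Suc c)"
    using tc by (intro span_base) (simp add: take_Suc_conv_app_nth)
  then have "(v c - bs ! (t + c)) + bs ! (t + c) \<in> flag bs (t + Suc c)"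
    using d flag_mono[of "t + c" "t + Suc c" bs] by (intro span_add) auto
  then have vc': "v c \<in> flag bs (t + Suc c)" by simp
  have ins: "X \<union> v ` {..<Suc c} = insert (v c) (X \<union> v ` {..<c})"
    by (auto simp: less_Suc_eq)
  have "dim (insert (v c) (X \<union> v ` {..<c})) = Suc (dim (X \<union> v ` {..<c}))"
    using vc vc' IH(2) flE by (intro dim_insert_notin) blast+
  moreover have "insert (v c) (X \<union> v ` {..<c}) \<subseteq> flag bs (t + Suc c)"
    using vc' IH(2) flag_mono[of "t + c" "t + Suc c" bs] by auto
  ultimately show ?case unfolding ins using IH(1) by simp
qed

text \<open>Counting the columns outside the flags bounds the rank by \<open>r1 + s + c3\<close>,
  and in every transversal the pivots of \<open>W\<close>, \<open>S\<close> and \<open>T\<close>,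
  stacked by \<open>dim_pivots\<close>, reach that number.\<close>

lemma flag_form_rank:
  assumes ff: "flag_form A J bs js r1 c1 s r3 c3"
    and A: "\<And>j. j \<in> J \<Longrightarrow> A j \<subseteq> E"
  shows "rank_bound A J (flag bs r1) \<le> r1 + s + c3"
    and "rank_bound A J (flag bs (r1 + s)) \<le> r1 + s + c3"
    and "\<And>a. (\<And>j. j \<in> J \<Longrightarrow> a j \<in> A j) \<Longrightarrow> dim (a ` J) = r1 + s + c3"
proof -
  have js: "set js = J" "distinct js" and bs: "span (set bs) = E" "length bs = dim E"
    and len: "r1 + s + r3 = length bs" "c1 + s + c3 = length js"
    and in1: "\<And>k. k < c1 \<Longrightarrow> A (js ! k) \<subseteq> flag bs r1"
    and in2: "\<And>k. k < c1 + s \<Longrightarrow> A (js ! k) \<subseteq> flag bs (r1 + s)"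
    using ff by (simp_all add: flag_form_def)
  have cnt: "card {j \<in> J. \<not> A j \<subseteq> U} \<le> length js - c"
    if U: "\<And>k. k < c \<Longrightarrow> A (js ! k) \<subseteq> U" for U c
  proof -
    have "{j \<in> J. \<not> A j \<subseteq> U} \<subseteq> (!) js ` {c..<length js}"
    proof
      fix j assume j: "j \<in> {j \<in> J. \<not> A j \<subseteq> U}"
      then obtain k where k: "k < length js" "j = js ! k" by (metis (no_types, lifting) in_set_conv_nth js(1) mem_Collect_eq)
      moreover have "\<not> k < c" using U[of k] j unfolding k(2) by blast
      ultimately show "j \<in> (!) js ` {c..<length js}" by auto
    qed
    then have "card {j \<in> J. \<not> A j \<subseteq> U} \<le> card ((!) js ` {c..<length js})"
      by (intro card_mono) auto
    also have "\<dots> \<le> length js - c" using card_image_le[of "{c..<length js}" "(!) js"] by simp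
    finally show ?thesis .
  qed
  show "rank_bound A J (flag bs r1) \<le> r1 + s + c3"
    using cnt[of c1, OF in1] dim_flag[OF bs, of r1] len by (simp add: rank_bound_def)
  show b2: "rank_bound A J (flag bs (r1 + s)) \<le> r1 + s + c3"
    using cnt[of "c1 + s", OF in2] dim_flag[OF bs, of "r1 + s"] len by (simp add: rank_bound_def)
  fix a assume a: "\<And>j. j \<in> J \<Longrightarrow> a j \<in> A j"
  have fin: "finite J" using js(1) by auto
  have bE: "set (take i bs) \<subseteq> E" for i
    using bs(1) span_superset set_take_subset by (metis subset_trans)
  have up: "dim (a ` J) \<le> r1 + s + c3"
    using rank_le_rank_bound[where a = a and A = A, OF fin a A subspace_span span_subset_E[OF bE]] b2 le_trans by blast
  have aj: "a (js ! k) \<in> A (js ! k)" if "k < length js" for k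
    using a js(1) nth_mem that by blast
  let ?v1 = "\<lambda>k. a (js ! k)" and ?v2 = "\<lambda>k. a (js ! (c1 + k))" and ?v3 = "\<lambda>k. a (js ! (c1 + s + k))"
  have r1: "r1 \<le> c1" "\<And>k. k < r1 \<Longrightarrow> ?v1 k - bs ! k \<in> flag bs k"
    using ff aj len(2) by (auto simp: flag_form_def pivot_def)
  have r2: "?v2 k - bs ! (r1 + k) \<in> flag bs (r1 + k)" if "k < s" for k
    using ff aj[of "c1 + k"] len(2) that by (auto simp: flag_form_def pivot_def)
  define t where "t = r1 + s + (r3 - c3)"
  have r3: "c3 \<le> r3" "\<And>k. k < c3 \<Longrightarrow> ?v3 k - bs ! (t + k) \<in> flag bs (t + k)"
    using ff aj len(2) by (auto simp: flag_form_def pivot_def t_def)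
  let ?X1 = "{} \<union> ?v1 ` {..<r1}"
  let ?X2 = "?X1 \<union> ?v2 ` {..<s}"
  let ?X3 = "?X2 \<union> ?v3 ` {..<c3}"
  have X1: "dim ?X1 = dim {} + r1 \<and> ?X1 \<subseteq> flag bs (0 + r1)"
    using r1 len by (intro dim_pivots[OF bs]) auto
  have X2: "dim ?X2 = dim ?X1 + s \<and> ?X2 \<subseteq> flag bs (r1 + s)"
    using r2 len X1 by (intro dim_pivots[OF bs]) auto
  have "flag bs (r1 + s) \<subseteq> flag bs t" by (rule flag_mono) (simp add: t_def)
  then have X3: "dim ?X3 = dim ?X2 + c3"
    using r3 len X2 by (intro dim_pivots[OF bs, of _ t, THEN conjunct1]) (auto simp: t_def)
  have aE: "a ` J \<subseteq> E" using a A by blast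
  have "?X3 \<subseteq> a ` J" using len(2) r1(1) by (auto simp: js(1)[symmetric])
  then have "dim ?X3 \<le> dim (a ` J)"
    using dim_le_of_subset_span[OF subset_trans[OF _ span_superset]] aE by blast
  then show "dim (a ` J) = r1 + s + c3" using up X1 X2 X3 by (simp add: dim_trivial)
qed

text \<open>The rank of any transversal is a lower bound for every value of
  \<open>rank_bound\<close>, and both flags attain it.\<close>

lemma flag_form_minimizers:
  assumes ff: "flag_form A J bs js r1 c1 s r3 c3"
    and A: "\<And>j. j \<in> J \<Longrightarrow> A j \<subseteq> E" "\<And>j. j \<in> J \<Longrightarrow> A j \<noteq> {}"
  shows "minimizer A J (flag bs r1)" "minimizer A J (flag bs (r1 + s))"
proof -
  have fin: "finite J" and bs: "span (set bs) = E" using ff by (auto simp: flag_form_def)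
  obtain a where a: "\<And>j. j \<in> J \<Longrightarrow> a j \<in> A j" 
    using ex_transversal[of J A] A(2) by auto
  have bE: "set (take i bs) \<subseteq> E" for i
    using bs span_superset set_take_subset by (metis subset_trans)
  have "r1 + s + c3 \<le> rank_bound A J U" if "subspace U" "U \<subseteq> E" for U
    using rank_le_rank_bound[where a = a and A = A, OF fin a A(1) that] flag_form_rank(3)[where a = a, OF ff A(1) a] by simp
  then show "minimizer A J (flag bs r1)" "minimizer A J (flag bs (r1 + s))"
    using flag_form_rank(1,2)[OF ff A(1)] span_subset_E[OF bE] le_trans
    unfolding minimizer_def by (meson subspace_span)+
qed

text \<open>The leading columns lie in the flag by definition, and minimality of the flag leaves no
  room for a further column inside it. So the flag alone determines which columns belong to each
  block, whatever their order.\<close>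

lemma flag_form_columns:
  assumes ff: "flag_form A J bs js r1 c1 s r3 c3"
    and A: "\<And>j. j \<in> J \<Longrightarrow> A j \<subseteq> E" "\<And>j. j \<in> J \<Longrightarrow> A j \<noteq> {}"
  shows "set (take c1 js) = {j \<in> J. A j \<subseteq> flag bs r1}"
    and "set (take (c1 + s) js) = {j \<in> J. A j \<subseteq> flag bs (r1 + s)}"
proof -
  have js: "set js = J" "distinct js" and bs: "span (set bs) = E" "length bs = dim E"
    and len: "r1 + s + r3 = length bs" "c1 + s + c3 = length js"
    and in1: "\<And>k. k < c1 \<Longrightarrow> A (js ! k) \<subseteq> flag bs r1"
    and in2: "\<And>k. k < c1 + s \<Longrightarrow> A (js ! k) \<subseteq> flag bs (r1 + s)"
    using ff by (simp_all add: flag_form_def)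
  obtain a where a: "\<And>j. j \<in> J \<Longrightarrow> a j \<in> A j" 
    using ex_transversal[of J A] A(2) by auto
  have fin: "finite J" using js(1) by auto
  have bE: "flag bs i \<subseteq> E" for i
    using bs(1) span_superset set_take_subset span_subset_E by (metis subset_trans)
  have main: "set (take c js) = {j \<in> J. A j \<subseteq> flag bs r}"
    if c: "\<And>k. k < c \<Longrightarrow> A (js ! k) \<subseteq> flag bs r" "c \<le> length js"
      and r: "r \<le> length bs" "r + (length js - c) = r1 + s + c3" for c r
  proof (rule card_subset_eq)
    show "finite {j \<in> J. A j \<subseteq> flag bs r}" using fin by simp
    show sub: "set (take c js) \<subseteq> {j \<in> J. A j \<subseteq> flag bs r}"
    proof
      fix j assume "j \<in> set (take c js)"
      then obtain k where "k < c" "j = js ! k" using c(2) by (auto simp: in_set_conv_nth)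
      then show "j \<in> {j \<in> J. A j \<subseteq> flag bs r}" using c js(1) nth_mem[of k js] by auto
    qed
    have "r1 + s + c3 \<le> rank_bound A J (flag bs r)"
      using rank_le_rank_bound[where a = a and A = A, OF fin a A(1) subspace_span bE] flag_form_rank(3)[where a = a, OF ff A(1) a] by simp
    then have "length js - c \<le> card {j \<in> J. \<not> A j \<subseteq> flag bs r}"
      using dim_flag[OF bs r(1)] r(2) by (simp add: rank_bound_def)
    moreover have "card J = card {j \<in> J. A j \<subseteq> flag bs r} + card {j \<in> J. \<not> A j \<subseteq> flag bs r}"
      using fin by (subst card_Un_disjoint[symmetric]) (auto intro!: arg_cong[of _ _ card])
    moreover have "card J = length js" using js distinct_card by metis
    ultimately have "card {j \<in> J. A j \<subseteq> flag bs r} \<le> c" using c(2) by simp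
    moreover have "card (set (take c js)) = c" using js(2) c(2) distinct_card[of "take c js"] by simp
    moreover have "card (set (take c js)) \<le> card {j \<in> J. A j \<subseteq> flag bs r}"
      using sub fin by (intro card_mono) auto
    ultimately show "card (set (take c js)) = card {j \<in> J. A j \<subseteq> flag bs r}" by simp
  qed
  show "set (take c1 js) = {j \<in> J. A j \<subseteq> flag bs r1}" using in1 len by (intro main) auto
  show "set (take (c1 + s) js) = {j \<in> J. A j \<subseteq> flag bs (r1 + s)}" using in2 len by (intro main) auto
qed

end

section \<open>Columns of completions\<close>

definition fscale :: "'a::field \<Rightarrow> (nat \<Rightarrow> 'a) \<Rightarrow> nat \<Rightarrow> 'a" where
  "fscale c f = (\<lambda>i. c * f i)"

text \<open>Column vectors of length \<open>m\<close> are encoded as functions vanishing from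
  \<open>m\<close> on. Functions form an additive group type independent of \<open>m\<close>, so
  \<open>span\<close> and \<open>dim\<close> of \<open>vector_space\<close> apply, and this subspace
  plays the part of \<open>E\<close>.\<close>

definition coord_space :: "nat \<Rightarrow> (nat \<Rightarrow> 'a::field) set" where
  "coord_space m = {f. \<forall>i\<ge>m. f i = 0}"

definition unit_fun :: "nat \<Rightarrow> nat \<Rightarrow> 'a::field" where
  "unit_fun k = (\<lambda>i. if i = k then 1 else 0)"

lemma sum_fun_apply: "(\<Sum>x\<in>S. f x) i = (\<Sum>x\<in>S. f x (i :: nat) :: 'a::field)"
  by (induction S rule: infinite_finite_induct) auto

interpretation fun_space: vector_space fscale
  by unfold_locales (auto simp: fscale_def fun_eq_iff algebra_simps)

lemma coord_space_expand:
  assumes "y \<in> coord_space m"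
  shows "y = (\<Sum>k<m. fscale (y k) (unit_fun k))"
proof
  fix i
  have "(\<Sum>k<m. y k * unit_fun k i) = (\<Sum>k<m. if k = i then y i else 0)"
    by (intro sum.cong) (auto simp: unit_fun_def)
  also have "\<dots> = y i" using assms by (auto simp: coord_space_def)
  finally show "y i = (\<Sum>k<m. fscale (y k) (unit_fun k)) i"
    by (simp add: sum_fun_apply fscale_def)
qed

lemma subspace_coord_space: "fun_space.subspace (coord_space m)"
  by (rule fun_space.subspaceI) (auto simp: coord_space_def fscale_def)

lemma coord_space_subset_span: "coord_space m \<subseteq> fun_space.span (unit_fun ` {..<m})"
proof
  fix y assume "y \<in> (coord_space m :: (nat \<Rightarrow> 'a) set)"
  then have "y = (\<Sum>k<m. fscale (y k) (unit_fun k))" by (rule coord_space_expand)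
  also have "\<dots> \<in> fun_space.span (unit_fun ` {..<m})"
    by (intro fun_space.span_sum fun_space.span_scale fun_space.span_base) auto
  finally show "y \<in> fun_space.span (unit_fun ` {..<m})" .
qed

lemma dim_coord_space: "fun_space.dim (coord_space m :: (nat \<Rightarrow> 'a::field) set) = m"
proof (rule fun_space.dim_unique[of "unit_fun ` {..<m}"])
  have inj: "inj (unit_fun :: nat \<Rightarrow> nat \<Rightarrow> 'a)"
    by (rule injI) (metis unit_fun_def zero_neq_one)
  show "unit_fun ` {..<m} \<subseteq> (coord_space m :: (nat \<Rightarrow> 'a) set)"
    by (auto simp: coord_space_def unit_fun_def)
  show "fun_space.independent (unit_fun ` {..<m} :: (nat \<Rightarrow> 'a) set)"
  proof (rule fun_space.independent_if_scalars_zero)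
    fix f :: "(nat \<Rightarrow> 'a) \<Rightarrow> 'a" and x :: "nat \<Rightarrow> 'a"
    assume sum: "(\<Sum>x\<in>unit_fun ` {..<m}. fscale (f x) x) = 0" and x: "x \<in> unit_fun ` {..<m}"
    obtain i where i: "i < m" "x = unit_fun i" using x by auto
    have "(\<Sum>k<m. fscale (f (unit_fun k)) (unit_fun k)) = 0"
      using sum by (subst (asm) sum.reindex[OF inj_on_subset[OF inj subset_UNIV]]) simp
    then have "(\<Sum>k<m. f (unit_fun k) * unit_fun k i) = 0"
      by (metis (no_types, lifting) fscale_def sum.cong sum_fun_apply zero_fun_apply)
    moreover have "(\<Sum>k<m. f (unit_fun k) * unit_fun k i) = (\<Sum>k<m. if k = i then f (unit_fun i) else 0)"
      by (intro sum.cong) (auto simp: unit_fun_def)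
    ultimately show "f x = 0" using i by simp
  qed simp
  show "card (unit_fun ` {..<m} :: (nat \<Rightarrow> 'a) set) = m"
    by (simp add: card_image[OF inj_on_subset[OF inj subset_UNIV]])
qed (rule coord_space_subset_span)

lemma finite_dim_coord_space: "finite_dim_subspace fscale (coord_space m)"
proof unfold_locales
  show "fun_space.subspace (coord_space m)" by (rule subspace_coord_space)
  show "\<exists>B. finite B \<and> coord_space m \<subseteq> fun_space.span B"
    using coord_space_subset_span by (intro exI[of _ "unit_fun ` {..<m}"]) auto
qed

section \<open>Matrix rank as a dimension of column functions\<close>

definition col_fun :: "nat \<Rightarrow> 'a::field mat \<Rightarrow> nat \<Rightarrow> nat \<Rightarrow> 'a" where
  "col_fun m X j = (\<lambda>i. if i < m then X $$ (i, j) else 0)"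

definition vec_fun :: "nat \<Rightarrow> 'a::field vec \<Rightarrow> nat \<Rightarrow> 'a" where
  "vec_fun m v = (\<lambda>i. if i < m then v $ i else 0)"

lemma inj_on_vec_fun: "inj_on (vec_fun m) (carrier_vec m)"
proof (rule inj_onI)
  fix v w :: "'a vec"
  assume vw: "v \<in> carrier_vec m" "w \<in> carrier_vec m" "vec_fun m v = vec_fun m w"
  show "v = w"
  proof (rule eq_vecI)
    fix i assume "i < dim_vec w"
    then have "i < m" using vw by simp
    then show "v $ i = w $ i" using fun_cong[OF vw(3), of i] by (simp add: vec_fun_def)
  qed (use vw in simp)
qed

lemma lincomb_eq_zero_iff:
  assumes "T \<subseteq> carrier_vec m" "finite T"
  shows "module.lincomb (module_vec TYPE('a::field) m) a T = 0\<^sub>v m \<longleftrightarrow>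
    (\<Sum>v\<in>T. fscale (a v) (vec_fun m v)) = 0"
proof -
  interpret vec_space "TYPE('a)" m .
  have "lincomb a T \<in> carrier_vec m" using assms by (intro lincomb_closed) auto
  then have "lincomb a T = 0\<^sub>v m \<longleftrightarrow> (\<forall>i<m. (\<Sum>v\<in>T. a v * v $ i) = 0)"
    using lincomb_index[OF _ assms(1)] by (auto simp: vec_eq_iff)
  also have "\<dots> \<longleftrightarrow> (\<Sum>v\<in>T. fscale (a v) (vec_fun m v)) = 0"
  proof -
    have "(\<Sum>v\<in>T. fscale (a v) (vec_fun m v)) = (\<lambda>i. if i < m then \<Sum>v\<in>T. a v * v $ i else 0)"
      by (auto simp: fun_eq_iff sum_fun_apply fscale_def vec_fun_def)
    then show ?thesis by (auto simp: fun_eq_iff)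
  qed
  finally show ?thesis .
qed

lemma lin_indpt_iff_independent:
  assumes "T \<subseteq> carrier_vec m" "finite T"
  shows "module.lin_dep class_ring (module_vec TYPE('a::field) m) T \<longleftrightarrow>
    fun_space.dependent (vec_fun m ` T)"
proof -
  interpret vec_space "TYPE('a)" m .
  have inj: "inj_on (vec_fun m) S" if "S \<subseteq> T" for S
    using inj_on_vec_fun assms(1) that by (meson inj_on_subset subset_trans)
  show ?thesis
  proof
    assume "lin_dep T"
    then obtain S a v where S: "finite S" "S \<subseteq> T" "lincomb a S = 0\<^sub>v m" "v \<in> S" "a v \<noteq> 0"
      unfolding lin_dep_def by auto
    \<comment> \<open>Coefficients are carried over along \<open>vec_fun\<close>, which is injective
      on \<open>S\<close>.\<close>
    define u where "u = (\<lambda>f. a (inv_into S (vec_fun m) f))"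
    have u: "u (vec_fun m w) = a w" if "w \<in> S" for w
      using that inj[OF S(2)] by (simp add: u_def)
    have "(\<Sum>f\<in>vec_fun m ` S. fscale (u f) f) = (\<Sum>w\<in>S. fscale (a w) (vec_fun m w))"
      using u by (subst sum.reindex[OF inj[OF S(2)]]) auto
    also have "\<dots> = 0" using lincomb_eq_zero_iff[of S m a] S assms(1) by auto
    finally show "fun_space.dependent (vec_fun m ` T)"
      unfolding fun_space.dependent_explicit using S u
      by (intro exI[of _ "vec_fun m ` S"] exI[of _ u]) auto
  next
    assume "fun_space.dependent (vec_fun m ` T)"
    then obtain F u where F: "finite F" "F \<subseteq> vec_fun m ` T" "(\<Sum>f\<in>F. fscale (u f) f) = 0"
      "\<exists>f\<in>F. u f \<noteq> 0"
      unfolding fun_space.dependent_explicit by blast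
    obtain S where S: "S \<subseteq> T" "F = vec_fun m ` S" using F(2) by (meson subset_imageE)
    have finS: "finite S" using S(1) assms(2) finite_subset by blast
    have "(\<Sum>w\<in>S. fscale (u (vec_fun m w)) (vec_fun m w)) = 0"
      using F(3) unfolding S(2) by (subst (asm) sum.reindex[OF inj[OF S(1)]]) simp
    then have "lincomb (u \<circ> vec_fun m) S = 0\<^sub>v m"
      using lincomb_eq_zero_iff[of S m "u \<circ> vec_fun m"] S(1) assms(1) finS by auto
    then show "lin_dep T"
      unfolding lin_dep_def using F(4) S finS
      by (intro exI[of _ S] exI[of _ "u \<circ> vec_fun m"]) auto
  qed
qed

text \<open>The rank is the size of a maximal independent set of columns; \<open>vec_fun\<close>
  preserves independence in both directions, so the image of that set is a basis of the span of all
  column functions.\<close>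

lemma mat_rank_eq_dim:
  assumes X: "X \<in> carrier_mat m n"
  shows "mat_rank (X :: 'a::field mat) = fun_space.dim (col_fun m X ` {..<n})"
proof -
  interpret vec_space "TYPE('a)" m .
  have cols: "set (cols X) \<subseteq> carrier_vec m" using cols_dim X by blast
  have img: "vec_fun m ` set (cols X) = col_fun m X ` {..<n}"
  proof -
    have "set (cols X) = col X ` {..<n}" using X by (auto simp: cols_def)
    moreover have "vec_fun m (col X j) = col_fun m X j" if "j < n" for j
      using X that by (auto simp: vec_fun_def col_fun_def)
    ultimately show ?thesis by (simp add: image_image cong: image_cong_simp)
  qed
  have "lin_indpt {}" by (simp add: lin_dep_def)
  then obtain S where S: "maximal S (\<lambda>T. T \<subseteq> set (cols X) \<and> lin_indpt T)"
    using maximal_exists_superset[of "set (cols X)" "\<lambda>T. T \<subseteq> set (cols X) \<and> lin_indpt T" "{}"]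
    by auto
  have S1: "S \<subseteq> set (cols X)" "lin_indpt S" using S unfolding maximal_def by auto
  have finS: "finite S" using S1(1) finite_subset by blast
  have SC: "S \<subseteq> carrier_vec m" using S1(1) cols by blast
  have "rank X = card S" using rank_card_indpt[OF X S] .
  also have "\<dots> = card (vec_fun m ` S)"
    using inj_on_vec_fun SC by (metis card_image inj_on_subset)
  also have "\<dots> = fun_space.dim (col_fun m X ` {..<n})"
  proof (rule fun_space.basis_card_eq_dim)
    show "vec_fun m ` S \<subseteq> col_fun m X ` {..<n}" using S1(1) img by blast
    show ind: "fun_space.independent (vec_fun m ` S)"
      using lin_indpt_iff_independent[OF SC finS] S1(2) by blast
    show "col_fun m X ` {..<n} \<subseteq> fun_space.span (vec_fun m ` S)"
      unfolding img[symmetric]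
    proof (rule image_subsetI, rule ccontr)
      fix v assume v: "v \<in> set (cols X)" "vec_fun m v \<notin> fun_space.span (vec_fun m ` S)"
      have "fun_space.independent (vec_fun m ` insert v S)"
        using fun_space.independent_insertI[OF v(2) ind] by simp
      then have "lin_indpt (insert v S)"
        using lin_indpt_iff_independent[of "insert v S" m] v(1) cols SC finS by blast
      then have "insert v S = S" using S v(1) S1(1) unfolding maximal_def by blast
      then show False using v(2) fun_space.span_base by blast
    qed
  qed
  finally show ?thesis using X by (simp add: mat_rank_def)
qed

text \<open>Row \<open>i\<close> of \<open>R\<close> as a linear functional: an entry of a product
  is then a functional applied to a column.\<close>

definition row_fun :: "nat \<Rightarrow> 'a::field mat \<Rightarrow> nat \<Rightarrow> (nat \<Rightarrow> 'a) \<Rightarrow> 'a" where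
  "row_fun m R i y = (\<Sum>k<m. R $$ (i, k) * y k)"

lemma row_fun_add: "row_fun m R i (x + y) = row_fun m R i x + row_fun m R i y"
  unfolding row_fun_def plus_fun_apply distrib_left sum.distrib ..

lemma row_fun_scale: "row_fun m R i (fscale c x) = c * row_fun m R i x"
  by (simp add: row_fun_def fscale_def sum_distrib_left mult_ac)

lemma row_fun_diff: "row_fun m R i (x - y) = row_fun m R i x - row_fun m R i y"
  by (simp add: row_fun_def sum_subtractf right_diff_distrib)

lemma row_fun_zero: "row_fun m R i 0 = 0"
  by (simp add: row_fun_def)

lemma row_fun_sum: "row_fun m R i (\<Sum>v\<in>V. f v) = (\<Sum>v\<in>V. row_fun m R i (f v))"
proof -
  have "row_fun m R i (\<Sum>v\<in>V. f v) = (\<Sum>k<m. \<Sum>v\<in>V. R $$ (i, k) * f v k)"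
    by (simp add: row_fun_def sum_fun_apply sum_distrib_left)
  also have "\<dots> = (\<Sum>v\<in>V. row_fun m R i (f v))"
    unfolding row_fun_def by (rule sum.swap)
  finally show ?thesis .
qed

lemma mult_entry:
  assumes "R \<in> carrier_mat l m" "X \<in> carrier_mat m n" "i < l" "j < n"
  shows "(R * X) $$ (i, j) = row_fun m R i (col_fun m X j)"
proof -
  have "(R * X) $$ (i, j) = (\<Sum>k = 0..<m. R $$ (i, k) * X $$ (k, j))"
    using assms by (simp add: scalar_prod_def)
  then show ?thesis by (simp add: row_fun_def col_fun_def atLeast0LessThan)
qed

definition perm_mat :: "nat \<Rightarrow> (nat \<Rightarrow> nat) \<Rightarrow> 'a::field mat" where
  "perm_mat n p = mat n n (\<lambda>(i, j). if i = p j then 1 else 0)"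

lemma mult_perm_mat_entry:
  assumes "X \<in> carrier_mat l n" "p permutes {..<n}" "i < l" "j < n"
  shows "(X * perm_mat n p) $$ (i, j) = X $$ (i, p j)"
proof -
  have pj: "p j < n" using assms(2,4) permutes_in_image by fastforce
  have "(X * perm_mat n p) $$ (i, j) = (\<Sum>k = 0..<n. X $$ (i, k) * (if k = p j then 1 else 0))"
    using assms by (simp add: perm_mat_def scalar_prod_def)
  also have "\<dots> = (\<Sum>k = 0..<n. if k = p j then X $$ (i, k) else 0)"
    by (intro sum.cong) auto
  finally show ?thesis using pj by simp
qed

section \<open>The column flats of an ACI-matrix\<close>

locale aci_matrix =
  fixes M :: "'a::field aci" and m n :: nat
  assumes aci: "aci_mat M m n"
begin

sublocale finite_dim_subspace fscale "coord_space m :: (nat \<Rightarrow> 'a) set"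
  by (rule finite_dim_coord_space)

lemma const_carrier: "aci_const M \<in> carrier_mat m n"
  and lin_carrier: "aci_lin M v \<in> carrier_mat m n"
  using aci unfolding aci_mat_def by blast+

lemma vars_def: "aci_vars M = {v. aci_lin M v \<noteq> 0\<^sub>m m n}"
  using const_carrier by (auto simp: aci_vars_def)

lemma finite_vars: "finite (aci_vars M)"
proof -
  obtain k where "\<forall>v\<ge>k. aci_lin M v = 0\<^sub>m m n" using aci by (auto simp: aci_mat_def)
  then have "aci_vars M \<subseteq> {..<k}" unfolding vars_def by (auto simp: not_le[symmetric])
  then show ?thesis using finite_subset by blast
qed

lemma completion_carrier: "completion M a \<in> carrier_mat m n"
  using const_carrier by (intro carrier_matI) (simp_all add: completion_def)

lemma completion_entry:
  assumes "i < m" "j < n"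
  shows "completion M a $$ (i, j) =
    aci_const M $$ (i, j) + (\<Sum>v\<in>aci_vars M. a v * aci_lin M v $$ (i, j))"
  using assms const_carrier by (simp add: completion_def)

definition colset :: "nat \<Rightarrow> (nat \<Rightarrow> 'a) set" where
  "colset j = range (\<lambda>a. col_fun m (completion M a) j)"

lemma colset_subset: "colset j \<subseteq> coord_space m"
  by (auto simp: colset_def coord_space_def col_fun_def)

lemma colset_nonempty: "colset j \<noteq> {}"
  by (simp add: colset_def)

lemma flat_colset:
  assumes j: "j < n"
  shows "flat (colset j)"
proof -
  let ?c = "\<lambda>a. col_fun m (completion M a) j"
  have "?c a + fscale t (?c b - ?c d) = ?c (\<lambda>v. a v + t * (b v - d v))" for a b d t
  proof
    fix i
    show "(?c a + fscale t (?c b - ?c d)) i = ?c (\<lambda>v. a v + t * (b v - d v)) i"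
    proof (cases "i < m")
      case True
      then show ?thesis
        using j by (simp add: col_fun_def fscale_def completion_entry algebra_simps sum.distrib
            sum_distrib_left sum_subtractf)
    qed (simp add: col_fun_def fscale_def)
  qed
  then show ?thesis unfolding flat_def colset_def by auto
qed

text \<open>The only place where it matters that no indeterminate occurs in two columns.\<close>

lemma transversal_is_completion:
  assumes x: "\<And>j. j < n \<Longrightarrow> x j \<in> colset j"
  obtains a where "\<And>j. j < n \<Longrightarrow> col_fun m (completion M a) j = x j"
proof -
  obtain b where b: "\<And>j. j < n \<Longrightarrow> x j = col_fun m (completion M (b j)) j"
  proof -
    have "\<forall>j\<in>{..<n}. \<exists>b. x j = col_fun m (completion M b) j" using x by (auto simp: colset_def)
    from bchoice[OF this] show thesis using that by auto
  qed
  \<comment> \<open>The one column in which \<open>v\<close> occurs, so that \<open>v\<close> takes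
    its value from the assignment chosen for that column. If \<open>v\<close> occurs nowhere the
    value is arbitrary, and its coefficients are zero.\<close>
  define owner where "owner v = (SOME j. j < n \<and> (\<exists>i<m. aci_lin M v $$ (i, j) \<noteq> 0))" for v
  have owner: "owner v = j" if "i < m" "j < n" "aci_lin M v $$ (i, j) \<noteq> 0" for i j v
  proof -
    have "\<exists>j. j < n \<and> (\<exists>i<m. aci_lin M v $$ (i, j) \<noteq> 0)" using that by blast
    from someI_ex[OF this] have "owner v < n \<and> (\<exists>i<m. aci_lin M v $$ (i, owner v) \<noteq> 0)"
      unfolding owner_def .
    then show ?thesis using that aci unfolding aci_mat_def by blast
  qed
  have "col_fun m (completion M (\<lambda>v. b (owner v) v)) j = x j" if j: "j < n" for j
  proof
    fix i
    show "col_fun m (completion M (\<lambda>v. b (owner v) v)) j i = x j i"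
    proof (cases "i < m")
      case True
      have "(\<Sum>v\<in>aci_vars M. b (owner v) v * aci_lin M v $$ (i, j)) =
        (\<Sum>v\<in>aci_vars M. b j v * aci_lin M v $$ (i, j))"
        using owner[OF True j] by (intro sum.cong) auto
      then show ?thesis using True j by (simp add: b col_fun_def completion_entry)
    qed (simp add: b j col_fun_def)
  qed
  then show thesis using that by blast
qed

lemma constantRank_iff:
  "constantRank M \<longleftrightarrow>
    (\<exists>\<rho>. \<forall>x. (\<forall>j\<in>{..<n}. x j \<in> colset j) \<longrightarrow> fun_space.dim (x ` {..<n}) = \<rho>)"
proof -
  let ?S = "{mat_rank (completion M a) | a. True}"
  have S: "mat_rank (completion M a) = fun_space.dim (col_fun m (completion M a) ` {..<n})" for a
    by (rule mat_rank_eq_dim[OF completion_carrier])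
  \<comment> \<open>Over an infinite field there may be infinitely many completions; the bound by
    \<open>n\<close> is what makes \<open>Max\<close> and \<open>Min\<close> meaningful.\<close>
  have "?S \<subseteq> {..n}"
  proof clarsimp
    fix a
    have "fun_space.dim (col_fun m (completion M a) ` {..<n}) \<le> card (col_fun m (completion M a) ` {..<n})"
      by (rule fun_space.dim_le_card') simp
    also have "\<dots> \<le> n" using card_image_le[of "{..<n}"] by simp
    finally show "mat_rank (completion M a) \<le> n" by (simp add: S)
  qed
  then have fin: "finite ?S" using finite_subset by blast
  have "constantRank M \<longleftrightarrow> (\<exists>\<rho>. \<forall>a. mat_rank (completion M a) = \<rho>)"
  proof
    assume "constantRank M"
    then have eq: "Max ?S = Min ?S" by (simp add: constantRank_def maxRank_def minRank_def)
    have "mat_rank (completion M a) = Max ?S" for a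
    proof (rule order_antisym)
      show "mat_rank (completion M a) \<le> Max ?S" using fin by (intro Max_ge) auto
      show "Max ?S \<le> mat_rank (completion M a)" unfolding eq using fin by (intro Min_le) auto
    qed
    then show "\<exists>\<rho>. \<forall>a. mat_rank (completion M a) = \<rho>" by blast
  next
    assume "\<exists>\<rho>. \<forall>a. mat_rank (completion M a) = \<rho>"
    then obtain \<rho> where "?S = {\<rho>}" by auto
    then show "constantRank M" by (simp add: constantRank_def maxRank_def minRank_def)
  qed
  also have "\<dots> \<longleftrightarrow> (\<exists>\<rho>. \<forall>x. (\<forall>j\<in>{..<n}. x j \<in> colset j) \<longrightarrow> fun_space.dim (x ` {..<n}) = \<rho>)"
  proof (intro iff_exI iffI allI impI)
    fix \<rho> x
    assume r: "\<forall>a. mat_rank (completion M a) = \<rho>" and x: "\<forall>j\<in>{..<n}. x j \<in> colset j"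
    obtain a where "\<And>j. j < n \<Longrightarrow> col_fun m (completion M a) j = x j"
      by (rule transversal_is_completion[of x]) (use x in auto)
    then have "x ` {..<n} = col_fun m (completion M a) ` {..<n}" by force
    then show "fun_space.dim (x ` {..<n}) = \<rho>" using r S by simp
  next
    fix \<rho> a
    assume "\<forall>x. (\<forall>j\<in>{..<n}. x j \<in> colset j) \<longrightarrow> fun_space.dim (x ` {..<n}) = \<rho>"
    then show "mat_rank (completion M a) = \<rho>" by (simp add: S colset_def)
  qed
  finally show ?thesis .
qed

text \<open>A polynomial of degree at most one is determined by its values over every field: the
  zero assignment gives the constant term, and assigning 1 to one indeterminate and 0 to the others
  gives a coefficient.\<close>

lemma aci_entry_const_iff:
  assumes R: "R \<in> carrier_mat m m" and p: "p permutes {..<n}" and ij: "i < m" "j < n"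
  shows "aci_entry_const (aci_mult R M (perm_mat n p)) i j c \<longleftrightarrow>
    (\<forall>y\<in>colset (p j). row_fun m R i y = c)"
proof -
  let ?N = "aci_mult R M (perm_mat n p)"
  have pj: "p j < n" using p ij(2) permutes_in_image by fastforce
  have ent: "(R * X * perm_mat n p) $$ (i, j) = row_fun m R i (col_fun m X (p j))"
    if X: "X \<in> carrier_mat m n" for X
    using mult_perm_mat_entry[of "R * X" m n p i j] mult_entry[OF R X ij(1) pj] R X p ij by simp
  have comp: "row_fun m R i (col_fun m (completion M a) (p j)) =
    aci_const ?N $$ (i, j) + (\<Sum>v\<in>aci_vars M. a v * aci_lin ?N v $$ (i, j))" for a
  proof -
    have "col_fun m (completion M a) (p j) = col_fun m (aci_const M) (p j) +
        (\<Sum>v\<in>aci_vars M. fscale (a v) (col_fun m (aci_lin M v) (p j)))"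
      using pj by (auto simp: fun_eq_iff col_fun_def completion_entry sum_fun_apply fscale_def)
    then show ?thesis
      by (simp only: row_fun_add row_fun_sum row_fun_scale)
        (simp add: aci_mult_def ent const_carrier lin_carrier)
  qed
  show ?thesis
  proof
    assume "aci_entry_const ?N i j c"
    then show "\<forall>y\<in>colset (p j). row_fun m R i y = c"
      by (auto simp: colset_def comp aci_entry_const_def)
  next
    assume "\<forall>y\<in>colset (p j). row_fun m R i y = c"
    then have all: "aci_const ?N $$ (i, j) + (\<Sum>v\<in>aci_vars M. a v * aci_lin ?N v $$ (i, j)) = c" for a
      by (simp add: colset_def comp[symmetric])
    have c: "aci_const ?N $$ (i, j) = c" using all[of "\<lambda>_. 0"] by simp
    have "aci_lin ?N v $$ (i, j) = 0" for v
    proof (cases "v \<in> aci_vars M")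
      case True
      have "(\<Sum>w\<in>aci_vars M. (if w = v then 1 else 0) * aci_lin ?N w $$ (i, j)) =
          (\<Sum>w\<in>aci_vars M. if w = v then aci_lin ?N v $$ (i, j) else 0)"
        by (intro sum.cong) auto
      then show ?thesis using all[of "\<lambda>w. if w = v then 1 else 0"] c True finite_vars by simp
    next
      case False
      then have "aci_lin M v = 0\<^sub>m m n" by (simp add: vars_def)
      then have "col_fun m (aci_lin M v) (p j) = 0" using pj by (auto simp: col_fun_def fun_eq_iff)
      then show ?thesis by (simp add: aci_mult_def ent[OF lin_carrier] row_fun_zero)
    qed
    then show "aci_entry_const ?N i j c" using c by (simp add: aci_entry_const_def)
  qed
qed

text \<open>The rows of \<open>R\<close> are the coordinate functionals of \<open>bs\<close>; for
  invertible \<open>R\<close> the list \<open>bs\<close> consists of the columns of the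
  inverse.\<close>

definition dual_basis :: "'a mat \<Rightarrow> (nat \<Rightarrow> 'a) list \<Rightarrow> bool" where
  "dual_basis R bs \<longleftrightarrow> length bs = m \<and> set bs \<subseteq> coord_space m \<and>
     (\<forall>i<m. \<forall>k<m. row_fun m R i (bs ! k) = (if i = k then 1 else 0)) \<and>
     (\<forall>y\<in>coord_space m. y = (\<Sum>k<m. fscale (row_fun m R k y) (bs ! k)))"

lemma dual_basis_inverse:
  assumes R: "R \<in> carrier_mat m m" and B: "B \<in> carrier_mat m m"
    and inv: "R * B = 1\<^sub>m m" "B * R = 1\<^sub>m m"
  shows "dual_basis R (map (col_fun m B) [0..<m])"
  unfolding dual_basis_def
proof (intro conjI ballI allI impI)
  show "set (map (col_fun m B) [0..<m]) \<subseteq> coord_space m"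
    by (auto simp: coord_space_def col_fun_def)
  fix i k assume "i < m" "k < m"
  then show "row_fun m R i (map (col_fun m B) [0..<m] ! k) = (if i = k then 1 else 0)"
    using mult_entry[OF R B, of i k] inv(1) by simp
next
  fix y :: "nat \<Rightarrow> 'a" assume y: "y \<in> coord_space m"
  show "y = (\<Sum>k<m. fscale (row_fun m R k y) (map (col_fun m B) [0..<m] ! k))"
  proof
    fix i
    show "y i = (\<Sum>k<m. fscale (row_fun m R k y) (map (col_fun m B) [0..<m] ! k)) i"
    proof (cases "i < m")
      case True
      have "(\<Sum>k<m. fscale (row_fun m R k y) (map (col_fun m B) [0..<m] ! k)) i =
          (\<Sum>k<m. (\<Sum>l<m. R $$ (k, l) * y l) * B $$ (i, k))"
        using True by (simp add: sum_fun_apply fscale_def col_fun_def row_fun_def)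
      also have "\<dots> = (\<Sum>k<m. \<Sum>l<m. B $$ (i, k) * R $$ (k, l) * y l)"
        by (simp add: sum_distrib_right sum_distrib_left mult_ac)
      also have "\<dots> = (\<Sum>l<m. \<Sum>k<m. B $$ (i, k) * R $$ (k, l) * y l)"
        by (rule sum.swap)
      also have "\<dots> = (\<Sum>l<m. (\<Sum>k<m. B $$ (i, k) * R $$ (k, l)) * y l)"
        by (simp add: sum_distrib_right)
      also have "\<dots> = (\<Sum>l<m. (if l = i then y i else 0))"
      proof (rule sum.cong)
        fix l assume "l \<in> {..<m}"
        then have l: "l < m" by simp
        have "(\<Sum>k<m. B $$ (i, k) * R $$ (k, l)) = (B * R) $$ (i, l)"
          using mult_entry[OF B R True l] l by (simp add: row_fun_def col_fun_def)
        then show "(\<Sum>k<m. B $$ (i, k) * R $$ (k, l)) * y l = (if l = i then y i else 0)"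
          using inv(2) True l by simp
      qed simp
      also have "\<dots> = y i" using True by simp
      finally show ?thesis by simp
    next
      case False
      then show ?thesis using y by (simp add: sum_fun_apply fscale_def col_fun_def coord_space_def)
    qed
  qed
qed simp

lemma invertible_mat_inverse:
  assumes R: "R \<in> carrier_mat m m" "invertible_mat (R :: 'a mat)"
  obtains B where "B \<in> carrier_mat m m" "R * B = 1\<^sub>m m" "B * R = 1\<^sub>m m"
proof -
  obtain B where B: "R * B = 1\<^sub>m (dim_row R)" "B * R = 1\<^sub>m (dim_row B)"
    using R(2) by (auto simp: invertible_mat_def inverts_mat_def)
  have "dim_col B = m" using B(1) R(1) by (metis carrier_matD(1) index_mult_mat(3) index_one_mat(3))
  moreover have "dim_row B = m" using B(2) R(1)
    by (metis carrier_matD(2) index_mult_mat(3) index_one_mat(3))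
  ultimately show thesis using that[of B] B R(1) by auto
qed

lemma span_set_list:
  assumes "y \<in> fun_space.span (set bs)"
  shows "\<exists>u. y = (\<Sum>k<length bs. fscale (u k) (bs ! k))"
  using assms
proof (induction rule: fun_space.span_induct_alt)
  case base
  show ?case by (intro exI[of _ "\<lambda>_. 0"]) simp
next
  case (step c x y)
  obtain u where u: "y = (\<Sum>k<length bs. fscale (u k) (bs ! k))" using step by blast
  obtain l where l: "l < length bs" "x = bs ! l" using step(1) by (auto simp: in_set_conv_nth)
  have "fscale c x + y = (\<Sum>k<length bs. fscale ((u(l := u l + c)) k) (bs ! k))"
    using l u by (simp add: sum.remove[of "{..<length bs}" l] fun_space.scale_left_distrib)
  then show ?case by blast
qed

text \<open>The columns of \<open>R\<close> are the coordinates of the unit vectors in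
  \<open>bs\<close>, so \<open>B * R\<close> is the identity by construction; both matrices are
  square, hence \<open>R * B\<close> is too.\<close>

lemma dual_matrix_exists:
  assumes bs: "fun_space.span (set bs) = coord_space m" "length bs = m"
  obtains R where "R \<in> carrier_mat m m" "invertible_mat R" "dual_basis R bs"
proof -
  have "\<forall>i\<in>{..<m}. \<exists>u. unit_fun i = (\<Sum>k<m. fscale (u k) (bs ! k))"
  proof
    fix i assume "i \<in> {..<m}"
    then have "unit_fun i \<in> fun_space.span (set bs)" unfolding bs(1)
      by (auto simp: coord_space_def unit_fun_def)
    then show "\<exists>u. unit_fun i = (\<Sum>k<m. fscale (u k) (bs ! k))" using span_set_list bs(2) by blast
  qed
  then obtain u where u: "\<And>i. i < m \<Longrightarrow> unit_fun i = (\<Sum>k<m. fscale (u i k) (bs ! k))"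
    by (metis lessThan_iff)
  define B where "B = mat m m (\<lambda>(i, k). (bs ! k) i)"
  define R where "R = mat m m (\<lambda>(k, i). u i k)"
  have c: "B \<in> carrier_mat m m" "R \<in> carrier_mat m m" by (auto simp: B_def R_def)
  have BR: "B * R = 1\<^sub>m m"
  proof (rule eq_matI)
    fix i j assume "i < dim_row (1\<^sub>m m :: 'a mat)" "j < dim_col (1\<^sub>m m :: 'a mat)"
    then have ij: "i < m" "j < m" by auto
    have "(B * R) $$ (i, j) = (\<Sum>k<m. u j k * (bs ! k) i)"
      using mult_entry[OF c ij] ij by (simp add: row_fun_def col_fun_def B_def R_def mult.commute)
    also have "\<dots> = unit_fun j i" by (simp add: u[OF ij(2)] sum_fun_apply fscale_def)
    finally show "(B * R) $$ (i, j) = 1\<^sub>m m $$ (i, j)" using ij by (simp add: unit_fun_def)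
  qed (use c in auto)
  then have RB: "R * B = 1\<^sub>m m" using mat_mult_left_right_inverse c by blast
  have "invertible_mat R" using c RB BR by (auto simp: invertible_mat_def inverts_mat_def)
  moreover have "map (col_fun m B) [0..<m] = bs"
  proof (rule nth_equalityI)
    fix k assume "k < length (map (col_fun m B) [0..<m])"
    then have k: "k < m" by simp
    then have "bs ! k \<in> coord_space m" using bs fun_space.span_base nth_mem by metis
    then show "map (col_fun m B) [0..<m] ! k = bs ! k"
      using k by (auto simp: fun_eq_iff col_fun_def B_def coord_space_def)
  qed (simp add: bs(2))
  then have "dual_basis R bs" using dual_basis_inverse[OF c(2,1) RB BR] by simp
  ultimately show thesis using c(2) that by blast
qed

text \<open>Only the last coordinates are tested: this is how zero blocks become inclusions of
  columns in flags.\<close>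

lemma in_flag_iff:
  assumes d: "dual_basis R bs" and y: "y \<in> coord_space m"
  shows "y \<in> flag bs r \<longleftrightarrow> (\<forall>i<m. r \<le> i \<longrightarrow> row_fun m R i y = 0)"
proof
  assume "y \<in> flag bs r"
  then show "\<forall>i<m. r \<le> i \<longrightarrow> row_fun m R i y = 0"
  proof (induction rule: fun_space.span_induct_alt)
    case (step c x y)
    then obtain k where "k < r" "k < m" "x = bs ! k"
      using d by (auto simp: in_set_conv_nth dual_basis_def)
    then show ?case
      using step d unfolding row_fun_add row_fun_scale by (auto simp: dual_basis_def)
  qed (simp only: row_fun_zero, simp)
next
  assume z: "\<forall>i<m. r \<le> i \<longrightarrow> row_fun m R i y = 0"
  have "(\<Sum>k<m. fscale (row_fun m R k y) (bs ! k)) \<in> flag bs r"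
  proof (rule fun_space.span_sum)
    fix k assume "k \<in> {..<m}"
    then have k: "k < m" by simp
    show "fscale (row_fun m R k y) (bs ! k) \<in> flag bs r"
    proof (cases "k < r")
      case True
      then have "bs ! k \<in> set (take r bs)" using d k by (auto simp: in_set_conv_nth dual_basis_def)
      then show ?thesis by (intro fun_space.span_scale fun_space.span_base)
    next
      case False
      then show ?thesis using z k fun_space.span_zero by simp
    qed
  qed
  moreover have "y = (\<Sum>k<m. fscale (row_fun m R k y) (bs ! k))"
    using d y by (simp add: dual_basis_def)
  ultimately show "y \<in> flag bs r" by simp
qed

lemma span_dual_basis:
  assumes d: "dual_basis R bs"
  shows "fun_space.span (set bs) = coord_space m"
proof
  show "fun_space.span (set bs) \<subseteq> coord_space m" using d span_subset_E by (auto simp: dual_basis_def)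
  show "coord_space m \<subseteq> fun_space.span (set bs)"
    using in_flag_iff[OF d, of _ m] d by (auto simp: dual_basis_def)
qed

end

section \<open>Normal forms\<close>

lemma sum_block:
  fixes f :: "nat \<Rightarrow> 'a::comm_monoid_add"
  assumes "a + r \<le> m" "\<And>k. k < a \<Longrightarrow> f k = 0" "\<And>k. a + r \<le> k \<Longrightarrow> k < m \<Longrightarrow> f k = 0"
  shows "(\<Sum>k<m. f k) = (\<Sum>k<r. f (a + k))"
proof -
  have "(\<Sum>k<m. f k) = (\<Sum>k\<in>{a..<a + r}. f k)"
    using assms by (intro sum.mono_neutral_right) (auto simp: not_less)
  also have "\<dots> = (\<Sum>k\<in>{0..<r}. f (a + k))"
    using sum.shift_bounds_nat_ivl[of f 0 a r] by (simp add: add.commute)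
  finally show ?thesis by (simp add: atLeast0LessThan)
qed

text \<open>The diagonal block of \<open>G\<close> is inverted by that of \<open>G'\<close>: in
  their product the terms before the block vanish by \<open>G\<close> and those after it by
  \<open>G'\<close>. In the product with \<open>N\<close> the terms after the block vanish by the
  zeros of \<open>N\<close>. So one edge condition on \<open>G\<close> and one on \<open>G'\<close>
  suffice, and all three blocks are covered.\<close>

lemma aci_equiv_diagonal_blocks:
  fixes N N' :: "'a::field aci"
  assumes carrier: "G \<in> carrier_mat m m" "G' \<in> carrier_mat m m" and inv: "G * G' = 1\<^sub>m m"
    and const: "\<And>i j. i < m \<Longrightarrow> j < n \<Longrightarrow>
      aci_const N' $$ (i, j) = (\<Sum>k<m. G $$ (i, k) * aci_const N $$ (k, \<pi> j))"
    and lin: "\<And>v i j. i < m \<Longrightarrow> j < n \<Longrightarrow>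
      aci_lin N' v $$ (i, j) = (\<Sum>k<m. G $$ (i, k) * aci_lin N v $$ (k, \<pi> j))"
    and size: "a + r \<le> m" "c + q \<le> n"
    and \<pi>: "inj \<pi>" "\<And>j. c \<le> j \<Longrightarrow> j < c + q \<Longrightarrow> c \<le> \<pi> j \<and> \<pi> j < c + q"
    and G: "\<And>i k. a \<le> i \<Longrightarrow> i < m \<Longrightarrow> k < a \<Longrightarrow> G $$ (i, k) = 0"
    and G': "\<And>i k. a + r \<le> i \<Longrightarrow> i < m \<Longrightarrow> k < a + r \<Longrightarrow> G' $$ (i, k) = 0"
    and N: "\<And>i j. a + r \<le> i \<Longrightarrow> i < m \<Longrightarrow> c \<le> j \<Longrightarrow> j < c + q \<Longrightarrow> aci_entry_const N i j 0"
  shows "aci_equiv (aci_block N a r c q) (aci_block N' a r c q)"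
proof -
  define H where "H = mat r r (\<lambda>(i, k). G $$ (a + i, a + k))"
  define H' where "H' = mat r r (\<lambda>(i, k). G' $$ (a + i, a + k))"
  \<comment> \<open>\<open>\<pi>\<close> shifted to the columns of the block, and the identity
    elsewhere, as \<open>permutes\<close> demands.\<close>
  define \<sigma> where "\<sigma> j = (if j < q then \<pi> (c + j) - c else j)" for j
  have Hc: "H \<in> carrier_mat r r" "H' \<in> carrier_mat r r" by (auto simp: H_def H'_def)
  have \<sigma>1: "c + \<sigma> j = \<pi> (c + j)" "\<sigma> j < q" if "j < q" for j
    using \<pi>(2)[of "c + j"] that by (auto simp: \<sigma>_def)
  have perm: "\<sigma> permutes {..<q}"
  proof (rule bij_imp_permutes)
    have "inj_on \<sigma> {..<q}"
    proof (rule inj_onI)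
      fix i j assume "i \<in> {..<q}" "j \<in> {..<q}" "\<sigma> i = \<sigma> j"
      then have "\<pi> (c + i) = \<pi> (c + j)" using \<sigma>1(1) by (metis lessThan_iff)
      then show "i = j" using \<pi>(1) by (simp add: inj_eq)
    qed
    moreover have "\<sigma> ` {..<q} \<subseteq> {..<q}" using \<sigma>1(2) by auto
    ultimately show "bij_betw \<sigma> {..<q} {..<q}"
      by (simp add: bij_betw_def endo_inj_surj)
  qed (simp add: \<sigma>_def)
  have "H * H' = 1\<^sub>m r"
  proof (rule eq_matI)
    fix i j assume "i < dim_row (1\<^sub>m r :: 'a mat)" "j < dim_col (1\<^sub>m r :: 'a mat)"
    then have ij: "i < r" "j < r" by auto
    have "(H * H') $$ (i, j) = (\<Sum>k<r. G $$ (a + i, a + k) * G' $$ (a + k, a + j))"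
      using mult_entry[OF Hc ij] ij by (simp add: row_fun_def col_fun_def H_def H'_def)
    also have "\<dots> = (\<Sum>k<m. G $$ (a + i, k) * G' $$ (k, a + j))"
      using G G' ij size(1) by (intro sum_block[symmetric]) auto
    also have "\<dots> = (G * G') $$ (a + i, a + j)"
      using mult_entry[OF carrier, of "a + i" "a + j"] ij size(1)
      by (simp add: row_fun_def col_fun_def)
    finally show "(H * H') $$ (i, j) = 1\<^sub>m r $$ (i, j)" using inv ij size(1) by simp
  qed (use Hc in auto)
  moreover from this have "H' * H = 1\<^sub>m r" using mat_mult_left_right_inverse Hc by blast
  ultimately have "invertible_mat H" using Hc by (auto simp: invertible_mat_def inverts_mat_def)
  have block: "mat r q (\<lambda>(i, j). X' $$ (a + i, c + j)) =
      H * mat r q (\<lambda>(i, j). X $$ (a + i, c + j)) * perm_mat q \<sigma>"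
    if X': "\<And>i j. i < m \<Longrightarrow> j < n \<Longrightarrow> X' $$ (i, j) = (\<Sum>k<m. G $$ (i, k) * X $$ (k, \<pi> j))"
      and X: "\<And>i j. a + r \<le> i \<Longrightarrow> i < m \<Longrightarrow> c \<le> j \<Longrightarrow> j < c + q \<Longrightarrow> X $$ (i, j) = 0" for X X'
  proof (rule eq_matI)
    let ?Y = "mat r q (\<lambda>(i, j). X $$ (a + i, c + j))"
    have Y: "?Y \<in> carrier_mat r q" by simp
    fix i j assume "i < dim_row (H * ?Y * perm_mat q \<sigma>)" "j < dim_col (H * ?Y * perm_mat q \<sigma>)"
    then have ij: "i < r" "j < q" using Hc by (auto simp: perm_mat_def)
    have "X' $$ (a + i, c + j) = (\<Sum>k<m. G $$ (a + i, k) * X $$ (k, \<pi> (c + j)))"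
      using ij size by (intro X') auto
    also have "\<dots> = (\<Sum>k<r. G $$ (a + i, a + k) * X $$ (a + k, \<pi> (c + j)))"
      using G X \<pi>(2)[of "c + j"] ij size(1) by (intro sum_block) auto
    also have "\<dots> = (H * ?Y) $$ (i, \<sigma> j)"
      using mult_entry[OF Hc(1) Y ij(1) \<sigma>1(2)[OF ij(2)]] ij \<sigma>1[OF ij(2)]
      by (simp add: row_fun_def col_fun_def H_def)
    also have "\<dots> = (H * ?Y * perm_mat q \<sigma>) $$ (i, j)"
      using mult_perm_mat_entry[OF _ perm ij, of "H * ?Y"] Hc by simp
    finally show "mat r q (\<lambda>(i, j). X' $$ (a + i, c + j)) $$ (i, j) = (H * ?Y * perm_mat q \<sigma>) $$ (i, j)"
      using ij by simp
  qed (use Hc in \<open>auto simp: perm_mat_def\<close>)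
  have "aci_block N' a r c q = aci_mult H (aci_block N a r c q) (perm_mat q \<sigma>)"
    unfolding aci_block_def aci_mult_def
    using block[OF const] block[OF lin] N by (auto simp: aci_entry_const_def)
  moreover have "permutation_mat q (perm_mat q \<sigma> :: 'a mat)"
    using perm by (auto simp: permutation_mat_def perm_mat_def)
  ultimately show ?thesis
    unfolding aci_equiv_def using Hc(1) \<open>invertible_mat H\<close>
    by (intro exI[of _ H] exI[of _ "perm_mat q \<sigma>"]) (auto simp: aci_block_def)
qed

text \<open>Zeros below the block turn unitriangularity into a condition on each column from the
  diagonal down to the last row, which is the shape of \<open>pivot\<close>.\<close>

lemma upper_unitri_at_iff:
  assumes "r + s \<le> m" "\<And>i k. r + s \<le> i \<Longrightarrow> i < m \<Longrightarrow> k < s \<Longrightarrow> aci_entry_const N i (c + k) 0"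
  shows "upper_unitri_at N r c s \<longleftrightarrow>
    (\<forall>k<s. \<forall>i<m. r + k \<le> i \<longrightarrow> aci_entry_const N i (c + k) (if i = r + k then 1 else 0))"
proof
  assume u: "upper_unitri_at N r c s"
  show "\<forall>k<s. \<forall>i<m. r + k \<le> i \<longrightarrow> aci_entry_const N i (c + k) (if i = r + k then 1 else 0)"
  proof (intro allI impI)
    fix k i assume k: "k < s" and i: "i < m" "r + k \<le> i"
    obtain l where l: "i = r + l" "k \<le> l" using i(2) by (metis add.assoc le_Suc_ex le_add1)
    show "aci_entry_const N i (c + k) (if i = r + k then 1 else 0)"
    proof (cases "l < s")
      case True
      then show ?thesis using u k l by (auto simp: upper_unitri_at_def)
    next
      case False
      then show ?thesis using assms(2)[of i k] k i l by auto
    qed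
  qed
next
  assume e: "\<forall>k<s. \<forall>i<m. r + k \<le> i \<longrightarrow> aci_entry_const N i (c + k) (if i = r + k then 1 else 0)"
  show "upper_unitri_at N r c s"
    unfolding upper_unitri_at_def
  proof (intro conjI allI impI)
    fix i assume "i < s"
    then show "aci_entry_const N (r + i) (c + i) 1" using e[rule_format, of i "r + i"] assms(1) by simp
  next
    fix i j assume "i < s" "j < s" "j < i"
    then show "aci_entry_const N (r + i) (c + j) 0" using e[rule_format, of j "r + i"] assms(1) by simp
  qed
qed

section \<open>Translation between block forms and flag forms, and uniqueness of the blocks\<close>

context aci_matrix
begin

text \<open>Each entry is a coordinate functional evaluated on a column flat. Zeros from row
  \<open>r\<close> down put the column into \<open>flag bs r\<close>, and a 1 with zeros below makes
  it a pivot.\<close>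

lemma block_form_iff_flag_form:
  assumes R: "R \<in> carrier_mat m m" and d: "dual_basis R bs" and p: "p permutes {..<n}"
  shows "block_form (aci_mult R M (perm_mat n p)) m n r1 c1 s r3 c3 \<longleftrightarrow>
    flag_form colset {..<n} bs (map p [0..<n]) r1 c1 s r3 c3"
proof (cases "r1 + s + r3 = m \<and> c1 + s + c3 = n")
  case False
  then show ?thesis using d by (auto simp: block_form_def flag_form_def dual_basis_def)
next
  case True
  define P where "P = aci_entry_const (aci_mult R M (perm_mat n p))"
  have P: "P i j c \<longleftrightarrow> (\<forall>y\<in>colset (p j). row_fun m R i y = c)" if "i < m" "j < n" for i j c
    unfolding P_def using aci_entry_const_iff[OF R p that] .
  have sub: "colset (map p [0..<n] ! j) \<subseteq> flag bs r \<longleftrightarrow> (\<forall>i<m. r \<le> i \<longrightarrow> P i j 0)"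
    if j: "j < n" for j r
  proof -
    have "colset (p j) \<subseteq> flag bs r \<longleftrightarrow>
        (\<forall>y\<in>colset (p j). \<forall>i<m. r \<le> i \<longrightarrow> row_fun m R i y = 0)"
      using in_flag_iff[OF d] colset_subset by (meson subset_eq)
    then show ?thesis using P j by auto
  qed
  have piv: "pivot bs k (colset (map p [0..<n] ! j)) \<longleftrightarrow>
      (\<forall>i<m. k \<le> i \<longrightarrow> P i j (if i = k then 1 else 0))"
    if j: "j < n" and k: "k < m" for j k
  proof -
    have bk: "bs ! k \<in> coord_space m" using d k by (auto simp: dual_basis_def)
    have "y - bs ! k \<in> flag bs k \<longleftrightarrow>
        (\<forall>i<m. k \<le> i \<longrightarrow> row_fun m R i y = (if i = k then 1 else 0))" if "y \<in> colset (p j)" for y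
    proof -
      have "y - bs ! k \<in> coord_space m"
        using that colset_subset bk fun_space.subspace_diff[OF subspace_coord_space] by blast
      moreover have "row_fun m R i (y - bs ! k) = row_fun m R i y - (if i = k then 1 else 0)"
        if "i < m" for i
        unfolding row_fun_diff using d k that by (simp add: dual_basis_def)
      ultimately show ?thesis using in_flag_iff[OF d] by (auto split: if_splits)
    qed
    then have "pivot bs k (colset (p j)) \<longleftrightarrow>
        (\<forall>y\<in>colset (p j). \<forall>i<m. k \<le> i \<longrightarrow> row_fun m R i y = (if i = k then 1 else 0))"
      by (simp add: pivot_def)
    also have "\<dots> \<longleftrightarrow> (\<forall>i<m. k \<le> i \<longrightarrow> P i j (if i = k then 1 else 0))"
      using P j by blast
    finally show ?thesis using j by simp
  qed
  have js: "set (map p [0..<n]) = {..<n}" "distinct (map p [0..<n])"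
    using permutes_image[OF p] permutes_inj_on[OF p] by (auto simp: distinct_map atLeast0LessThan)
  have bs: "fun_space.span (set bs) = coord_space m" "length bs = m"
    using span_dual_basis[OF d] d by (auto simp: dual_basis_def)
  let ?Z = "\<forall>i<m. \<forall>j<n. ((r1 \<le> i \<and> j < c1) \<or> (r1 + s \<le> i \<and> j < c1 + s)) \<longrightarrow> P i j 0"
  have Z: "?Z \<longleftrightarrow> (\<forall>k<c1. colset (map p [0..<n] ! k) \<subseteq> flag bs r1) \<and>
      (\<forall>k<c1 + s. colset (map p [0..<n] ! k) \<subseteq> flag bs (r1 + s))"
    using sub True by auto
  have U: "upper_unitri_at (aci_mult R M (perm_mat n p)) r c t \<longleftrightarrow>
      (\<forall>k<t. pivot bs (r + k) (colset (map p [0..<n] ! (c + k))))"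
    if z: "\<And>i k. r + t \<le> i \<Longrightarrow> i < m \<Longrightarrow> k < t \<Longrightarrow> P i (c + k) 0"
      and l: "r + t \<le> m" "c + t \<le> n" for r c t
  proof -
    have "upper_unitri_at (aci_mult R M (perm_mat n p)) r c t \<longleftrightarrow>
        (\<forall>k<t. \<forall>i<m. r + k \<le> i \<longrightarrow> P i (c + k) (if i = r + k then 1 else 0))"
      unfolding P_def by (rule upper_unitri_at_iff[OF l(1)]) (use z in \<open>simp add: P_def\<close>)
    also have "\<dots> \<longleftrightarrow> (\<forall>k<t. pivot bs (r + k) (colset (map p [0..<n] ! (c + k))))"
      using piv[of "c + k" "r + k" for k] l by (auto simp del: nth_map)
    finally show ?thesis .
  qed
  let ?U = "upper_unitri_at (aci_mult R M (perm_mat n p))"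
  let ?A = "\<lambda>k. colset (map p [0..<n] ! k)"
  have u1: "?U 0 0 r1 \<longleftrightarrow> (\<forall>k<r1. pivot bs k (?A k))" if ?Z "r1 < c1"
    using U[of 0 r1 0] that True by (simp del: nth_map)
  have u2: "?U r1 c1 s \<longleftrightarrow> (\<forall>k<s. pivot bs (r1 + k) (?A (c1 + k)))" if ?Z
    using U[of r1 s c1] that True by (simp del: nth_map)
  \<comment> \<open>The unitriangular part of \<open>T\<close> ends at row \<open>m\<close>, so
    nothing below it has to vanish; for \<open>W\<close> and \<open>S\<close> the zeros come from
    the zero blocks.\<close>
  have u3: "?U (r1 + s + (r3 - c3)) (c1 + s) c3 \<longleftrightarrow>
      (\<forall>k<c3. pivot bs (r1 + s + (r3 - c3) + k) (?A (c1 + s + k)))" if "c3 < r3"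
  proof (rule U)
    show "r1 + s + (r3 - c3) + c3 \<le> m" "c1 + s + c3 \<le> n" using True that by auto
    show "P i (c1 + s + k) 0" if "r1 + s + (r3 - c3) + c3 \<le> i" "i < m" for i k
      using that True \<open>c3 < r3\<close> by simp
  qed
  have "block_form (aci_mult R M (perm_mat n p)) m n r1 c1 s r3 c3 \<longleftrightarrow> ?Z \<and>
      (r1 = 0 \<or> r1 < c1 \<and> ?U 0 0 r1) \<and> ?U r1 c1 s \<and>
      (c3 = 0 \<or> c3 < r3 \<and> ?U (r1 + s + (r3 - c3)) (c1 + s) c3)"
    unfolding block_form_def P_def using True by blast
  also have "\<dots> \<longleftrightarrow> ?Z \<and> (r1 = 0 \<or> r1 < c1 \<and> (\<forall>k<r1. pivot bs k (?A k))) \<and>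
      (\<forall>k<s. pivot bs (r1 + k) (?A (c1 + k))) \<and>
      (c3 = 0 \<or> c3 < r3 \<and> (\<forall>k<c3. pivot bs (r1 + s + (r3 - c3) + k) (?A (c1 + s + k))))"
    using u1 u2 u3 by argo
  also have "\<dots> \<longleftrightarrow> flag_form colset {..<n} bs (map p [0..<n]) r1 c1 s r3 c3"
    unfolding flag_form_def Z bs(2) dim_coord_space
    using True js bs(1) by (simp only: length_map length_upt) simp
  finally show ?thesis .
qed

lemma normal_form_imp_flag_form:
  assumes "normal_form M m n R Q r1 c1 s r3 c3"
  obtains B p where "R \<in> carrier_mat m m" "B \<in> carrier_mat m m" "R * B = 1\<^sub>m m" "B * R = 1\<^sub>m m"
    "p permutes {..<n}" "Q = perm_mat n p"
    "flag_form colset {..<n} (map (col_fun m B) [0..<m]) (map p [0..<n]) r1 c1 s r3 c3"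
proof -
  have R: "R \<in> carrier_mat m m" "invertible_mat R"
    and bf: "block_form (aci_mult R M Q) m n r1 c1 s r3 c3"
    using assms by (auto simp: normal_form_def)
  obtain p where p: "p permutes {..<n}" "Q = perm_mat n p"
    using assms by (auto simp: normal_form_def permutation_mat_def perm_mat_def)
  obtain B where B: "B \<in> carrier_mat m m" "R * B = 1\<^sub>m m" "B * R = 1\<^sub>m m"
    using invertible_mat_inverse[OF R] by blast
  have "flag_form colset {..<n} (map (col_fun m B) [0..<m]) (map p [0..<n]) r1 c1 s r3 c3"
    using block_form_iff_flag_form[OF R(1) dual_basis_inverse[OF R(1) B] p(1)] bf p(2) by blast
  then show thesis using that[OF R(1) B p] by blast
qed

lemma flag_form_imp_normal_form:
  assumes ff: "flag_form colset {..<n} bs js r1 c1 s r3 c3"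
  shows "\<exists>R Q. normal_form M m n R Q r1 c1 s r3 c3"
proof -
  have bs: "fun_space.span (set bs) = coord_space m" "length bs = m"
    and js: "set js = {..<n}" "distinct js"
    using ff dim_coord_space[of m, where 'a = 'a] by (auto simp: flag_form_def)
  have len: "length js = n" using js distinct_card[of js] by simp
  obtain R where R: "R \<in> carrier_mat m m" "invertible_mat R" "dual_basis R bs"
    using dual_matrix_exists[OF bs] by blast
  define p where "p j = (if j < n then js ! j else j)" for j
  have map: "map p [0..<n] = js" by (rule nth_equalityI) (auto simp: p_def len)
  have p: "p permutes {..<n}"
  proof (rule bij_imp_permutes)
    have "inj_on p {..<n}" using js(2) len by (auto simp: inj_on_def p_def nth_eq_iff_index_eq)
    moreover have "p ` {..<n} = {..<n}" using js(1) map by (metis atLeast0LessThan set_map set_upt)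
    ultimately show "bij_betw p {..<n} {..<n}" by (simp add: bij_betw_def)
  qed (simp add: p_def)
  have "block_form (aci_mult R M (perm_mat n p)) m n r1 c1 s r3 c3"
    using block_form_iff_flag_form[OF R(1,3) p] ff map by simp
  moreover have "permutation_mat n (perm_mat n p :: 'a mat)"
    using p by (auto simp: permutation_mat_def perm_mat_def)
  ultimately show ?thesis using R by (auto simp: normal_form_def)
qed

lemma flag_form_with_extreme_minimizers:
  assumes card: "infinite (UNIV :: 'a set) \<or> n < card (UNIV :: 'a set)"
    and rank: "constantRank M"
    and V: "minimizer colset {..<n} V" "\<And>U. minimizer colset {..<n} U \<Longrightarrow> V \<subseteq> U"
    and W: "minimizer colset {..<n} W" "\<And>U. minimizer colset {..<n} U \<Longrightarrow> U \<subseteq> W"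
  shows "\<exists>R Q c1 s r3 c3. normal_form M m n R Q (fun_space.dim V) c1 s r3 c3 \<and>
    fun_space.dim W = fun_space.dim V + s"
proof -
  obtain \<rho> where \<rho>: "\<And>x. (\<And>j. j \<in> {..<n} \<Longrightarrow> x j \<in> colset j) \<Longrightarrow> fun_space.dim (x ` {..<n}) = \<rho>"
    using rank unfolding constantRank_iff by blast
  have "\<exists>bs js c1 s r3 c3. flag_form colset {..<n} bs js (fun_space.dim V) c1 s r3 c3 \<and>
      fun_space.dim W = fun_space.dim V + s"
    by (rule flag_form_of_constant_rank[OF _ _ _ colset_subset \<rho> V W]) (use card flat_colset in auto)
  then show ?thesis using flag_form_imp_normal_form by meson
qed

lemma normal_form_imp_constantRank:
  assumes "normal_form M m n R Q r1 c1 s r3 c3"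
  shows "constantRank M"
proof -
  obtain B p where "flag_form colset {..<n} (map (col_fun m B) [0..<m]) (map p [0..<n]) r1 c1 s r3 c3"
    using normal_form_imp_flag_form[OF assms] by metis
  from flag_form_rank(3)[OF this colset_subset] show ?thesis
    unfolding constantRank_iff by blast
qed

text \<open>\<open>R' * B\<close> writes the first basis in the coordinates of the second. The
  common flag at \<open>a\<close> gives it the zeros left of the block, the common flag at
  \<open>a + r\<close> gives its inverse \<open>R * B'\<close> the zeros below, and the common
  column sets keep the columns of the block together.\<close>

lemma diagonal_blocks_equiv:
  assumes R: "R \<in> carrier_mat m m" and B: "B \<in> carrier_mat m m" "R * B = 1\<^sub>m m" "B * R = 1\<^sub>m m"
    and R': "R' \<in> carrier_mat m m" and B': "B' \<in> carrier_mat m m" "R' * B' = 1\<^sub>m m" "B' * R' = 1\<^sub>m m"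
    and p: "p permutes {..<n}" and p': "p' permutes {..<n}"
    and flag: "flag (map (col_fun m B) [0..<m]) a = flag (map (col_fun m B') [0..<m]) a"
      "flag (map (col_fun m B) [0..<m]) (a + r) = flag (map (col_fun m B') [0..<m]) (a + r)"
    and img: "p ` {..<c} = p' ` {..<c}" "p ` {..<c + q} = p' ` {..<c + q}"
    and size: "a + r \<le> m" "c + q \<le> n"
    and zero: "\<And>i j. a + r \<le> i \<Longrightarrow> i < m \<Longrightarrow> c \<le> j \<Longrightarrow> j < c + q \<Longrightarrow>
      aci_entry_const (aci_mult R M (perm_mat n p)) i j 0"
  shows "aci_equiv (aci_block (aci_mult R M (perm_mat n p)) a r c q)
    (aci_block (aci_mult R' M (perm_mat n p')) a r c q)"
proof -
  \<comment> \<open>The change of column order: column \<open>j\<close> of the second form is column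
    \<open>\<pi> j\<close> of the first.\<close>
  define \<pi> where "\<pi> = inv_into UNIV p \<circ> p'"
  have \<pi>p: "p (\<pi> j) = p' j" for j using permutes_inverses(1)[OF p] by (simp add: \<pi>_def)
  have p_lt: "p j < n" "p' j < n" "\<pi> j < n" if "j < n" for j
    using that permutes_in_image[OF p] permutes_in_image[OF p']
      permutes_in_image[OF permutes_inv[OF p]] by (auto simp: \<pi>_def)
  have inj: "inj p" "inj p'" using permutes_inj p p' by auto
  have inj\<pi>: "inj \<pi>" using inj(2) \<pi>p by (metis injI inj_eq)
  have \<pi>_lt: "\<pi> j < t \<longleftrightarrow> j < t" if "p ` {..<t} = p' ` {..<t}" for j t
  proof -
    have "\<pi> j < t \<longleftrightarrow> p (\<pi> j) \<in> p ` {..<t}" using inj(1) by (auto simp: inj_image_mem_iff)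
    also have "\<dots> \<longleftrightarrow> p' j \<in> p' ` {..<t}" by (simp add: \<pi>p that)
    also have "\<dots> \<longleftrightarrow> j < t" using inj(2) by (auto simp: inj_image_mem_iff)
    finally show ?thesis .
  qed
  have entry: "(R' * X * perm_mat n p') $$ (i, j) =
      (\<Sum>k<m. (R' * B) $$ (i, k) * (R * X * perm_mat n p) $$ (k, \<pi> j))"
    if X: "X \<in> carrier_mat m n" and ij: "i < m" "j < n" for X i j
  proof -
    have RX: "R * X \<in> carrier_mat m n" "R' * X \<in> carrier_mat m n" "R' * B \<in> carrier_mat m m"
      using R R' B X by auto
    have "R' * X = R' * (B * R * X)" using X B(3) by simp
    also have "\<dots> = (R' * B) * (R * X)" using R R' B(1) X by (simp add: assoc_mult_mat[of _ m m _ m _ n])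
    finally have eq: "R' * X = (R' * B) * (R * X)" .
    have "(R' * X * perm_mat n p') $$ (i, j) = ((R' * B) * (R * X)) $$ (i, p' j)"
      using mult_perm_mat_entry[OF RX(2) p' ij] eq by simp
    also have "\<dots> = (\<Sum>k<m. (R' * B) $$ (i, k) * (R * X) $$ (k, p' j))"
      using mult_entry[OF RX(3,1) ij(1) p_lt(2)[OF ij(2)]] by (simp add: row_fun_def col_fun_def)
    also have "\<dots> = (\<Sum>k<m. (R' * B) $$ (i, k) * (R * X * perm_mat n p) $$ (k, \<pi> j))"
      using mult_perm_mat_entry[OF RX(1) p _ p_lt(3)[OF ij(2)]] \<pi>p by simp
    finally show ?thesis .
  qed
  \<comment> \<open>Column \<open>k\<close> of \<open>C\<close> lies in the flag shared with
    \<open>D\<close>, and the rows of \<open>S\<close> are the coordinates with respect to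
    \<open>D\<close>, so those from \<open>t\<close> on vanish.\<close>
  have lower: "(S * C) $$ (i, k) = 0"
    if S: "S \<in> carrier_mat m m" "D \<in> carrier_mat m m" "S * D = 1\<^sub>m m" "D * S = 1\<^sub>m m"
      and C: "C \<in> carrier_mat m m"
      and fl: "flag (map (col_fun m C) [0..<m]) t = flag (map (col_fun m D) [0..<m]) t"
      and ik: "t \<le> i" "i < m" "k < t" for S C D t i k
  proof -
    have k: "k < m" using ik by simp
    have "col_fun m C k = take t (map (col_fun m C) [0..<m]) ! k" "k < length (take t (map (col_fun m C) [0..<m]))"
      using ik by auto
    then have "col_fun m C k \<in> flag (map (col_fun m C) [0..<m]) t"
      by (metis fun_space.span_base nth_mem)
    moreover have "col_fun m C k \<in> coord_space m" by (simp add: col_fun_def coord_space_def)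
    ultimately have "row_fun m S i (col_fun m C k) = 0"
      using in_flag_iff[OF dual_basis_inverse[OF S]] fl ik by blast
    then show ?thesis using mult_entry[OF S(1) C ik(2) k] by simp
  qed
  show ?thesis
  proof (rule aci_equiv_diagonal_blocks[where G = "R' * B" and G' = "R * B'" and \<pi> = \<pi> and m = m and n = n])
    show "R' * B \<in> carrier_mat m m" "R * B' \<in> carrier_mat m m" using R R' B B' by auto
    have "R' * B * (R * B') = R' * (B * R) * B'"
      using R R' B(1) B'(1) by (simp add: assoc_mult_mat[of _ m m _ m _ m])
    then show "R' * B * (R * B') = 1\<^sub>m m" using B(3) B'(2) R' by simp
    show "inj \<pi>" by (rule inj\<pi>)
    show "c \<le> \<pi> j \<and> \<pi> j < c + q" if "c \<le> j" "j < c + q" for j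
      using that \<pi>_lt[OF img(1), of j] \<pi>_lt[OF img(2), of j] by simp
    show "(R' * B) $$ (i, k) = 0" if "a \<le> i" "i < m" "k < a" for i k
      using lower[OF R' B' B(1) flag(1) that] .
    show "(R * B') $$ (i, k) = 0" if "a + r \<le> i" "i < m" "k < a + r" for i k
      using lower[OF R B B'(1) flag(2)[symmetric] that] .
  qed (use size zero entry const_carrier lin_carrier in \<open>auto simp: aci_mult_def\<close>)
qed

text \<open>The flags of any normal form lie between \<open>V\<close> and \<open>W\<close>, so
  \<open>s\<close> is at most \<open>dim W - dim V\<close>. The construction from constant rank
  reaches this value, hence so does a maximal \<open>s\<close>, and flags of the right dimensions
  coincide with \<open>V\<close> and \<open>W\<close>.\<close>

lemma maximal_normal_form:
  assumes card: "infinite (UNIV :: 'a set) \<or> n < card (UNIV :: 'a set)"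
    and nf: "normal_form M m n R Q r1 c1 s r3 c3"
    and max: "\<And>R Q r1 c1 s' r3 c3. normal_form M m n R Q r1 c1 s' r3 c3 \<Longrightarrow> s' \<le> s"
    and V: "minimizer colset {..<n} V" "\<And>U. minimizer colset {..<n} U \<Longrightarrow> V \<subseteq> U"
    and W: "minimizer colset {..<n} W" "\<And>U. minimizer colset {..<n} U \<Longrightarrow> U \<subseteq> W"
  obtains B p where "R \<in> carrier_mat m m" "B \<in> carrier_mat m m" "R * B = 1\<^sub>m m" "B * R = 1\<^sub>m m"
    "p permutes {..<n}" "Q = perm_mat n p"
    "flag (map (col_fun m B) [0..<m]) r1 = V" "flag (map (col_fun m B) [0..<m]) (r1 + s) = W"
    "p ` {..<c1} = {j \<in> {..<n}. colset j \<subseteq> V}" "p ` {..<c1 + s} = {j \<in> {..<n}. colset j \<subseteq> W}"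
    "r1 = fun_space.dim V" "r1 + s = fun_space.dim W"
    "c1 = card {j \<in> {..<n}. colset j \<subseteq> V}" "r1 + s + r3 = m" "c1 + s + c3 = n"
proof -
  obtain B p where R: "R \<in> carrier_mat m m" "B \<in> carrier_mat m m" "R * B = 1\<^sub>m m" "B * R = 1\<^sub>m m"
    and p: "p permutes {..<n}" "Q = perm_mat n p"
    and ff: "flag_form colset {..<n} (map (col_fun m B) [0..<m]) (map p [0..<n]) r1 c1 s r3 c3"
    using normal_form_imp_flag_form[OF nf] by blast
  let ?bs = "map (col_fun m B) [0..<m]"
  have size: "r1 + s + r3 = m" "c1 + s + c3 = n"
    and bs: "fun_space.span (set ?bs) = coord_space m" "length ?bs = fun_space.dim (coord_space m :: (nat \<Rightarrow> 'a) set)"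
    using ff unfolding flag_form_def by simp_all
  have dims: "fun_space.dim (flag ?bs i) = i" if "i \<le> m" for i
    using dim_flag[OF bs, of i] that by simp
  have flE: "flag ?bs i \<subseteq> coord_space m" for i
    by (rule span_subset_E) (auto simp: coord_space_def col_fun_def dest!: in_set_takeD)
  have sub: "fun_space.subspace V" "V \<subseteq> coord_space m" "fun_space.subspace W" "W \<subseteq> coord_space m"
    using V W by (auto simp: minimizer_def)
  have VF: "V \<subseteq> flag ?bs r1" and FW: "flag ?bs (r1 + s) \<subseteq> W"
    using flag_form_minimizers[OF ff colset_subset colset_nonempty] V(2) W(2) by auto
  have dV: "fun_space.dim V \<le> r1"
    using dim_le_of_subset_span[of V "flag ?bs r1"] VF fun_space.span_superset[of "flag ?bs r1"]
      flE dims[of r1] size by auto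
  have dW: "r1 + s \<le> fun_space.dim W"
    using dim_le_of_subset_span[of "flag ?bs (r1 + s)" W] FW fun_space.span_superset[of W]
      sub(4) dims[of "r1 + s"] size by auto
  obtain R0 Q0 c0 s0 r0 c0' where "normal_form M m n R0 Q0 (fun_space.dim V) c0 s0 r0 c0'"
    "fun_space.dim W = fun_space.dim V + s0"
    using flag_form_with_extreme_minimizers[OF card normal_form_imp_constantRank[OF nf] V W] by blast
  then have dd: "fun_space.dim V = r1" "fun_space.dim W = r1 + s"
    using max[of R0 Q0 "fun_space.dim V" c0 s0 r0 c0'] dV dW by auto
  have V_eq: "flag ?bs r1 = V"
    using subspace_eq_of_dim_le[OF sub(1) VF flE] dims[of r1] dd size by simp
  have W_eq: "flag ?bs (r1 + s) = W"
    using subspace_eq_of_dim_le[OF fun_space.subspace_span FW sub(4)] dims[of "r1 + s"] dd size by simp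
  have tk: "set (take t (map p [0..<n])) = p ` {..<t}" if "t \<le> n" for t
    using that by (simp add: take_map min_def atLeast0LessThan)
  have P: "p ` {..<c1} = {j \<in> {..<n}. colset j \<subseteq> V}" "p ` {..<c1 + s} = {j \<in> {..<n}. colset j \<subseteq> W}"
    using flag_form_columns[OF ff colset_subset colset_nonempty] tk[of c1] tk[of "c1 + s"] size(2)
    unfolding V_eq W_eq by auto
  have "card (p ` {..<c1}) = c1" using permutes_inj[OF p(1)] by (simp add: card_image inj_on_def inj_def)
  then show thesis using that[OF R p V_eq W_eq P] dd size P(1) by simp
qed

end

theorem theorem7p2:
  fixes M :: "'a::field aci" and m n :: nat
  assumes "aci_mat M m n"
    and "infinite (UNIV :: 'a set) \<or> max m (n + 1) \<le> card (UNIV :: 'a set)"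
  shows "(constantRank M \<longleftrightarrow>
            (\<exists>R Q r1 c1 s r3 c3. normal_form M m n R Q r1 c1 s r3 c3))
       \<and> (\<forall>R Q r1 c1 s r3 c3 R' Q' r1' c1' s' r3' c3'.
            normal_form M m n R Q r1 c1 s r3 c3 \<longrightarrow>
            normal_form M m n R' Q' r1' c1' s' r3' c3' \<longrightarrow>
            (\<forall>R'' Q'' r1'' c1'' s'' r3'' c3''.
               normal_form M m n R'' Q'' r1'' c1'' s'' r3'' c3'' \<longrightarrow> s'' \<le> s) \<longrightarrow>
            (\<forall>R'' Q'' r1'' c1'' s'' r3'' c3''.
               normal_form M m n R'' Q'' r1'' c1'' s'' r3'' c3'' \<longrightarrow> s'' \<le> s') \<longrightarrow>
            (let N = aci_mult R M Q; N' = aci_mult R' M Q' in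
               aci_equiv (aci_block N 0 r1 0 c1) (aci_block N' 0 r1' 0 c1') \<and>
               aci_equiv (aci_block N r1 s c1 s) (aci_block N' r1' s' c1' s') \<and>
               aci_equiv (aci_block N (r1 + s) r3 (c1 + s) c3)
                         (aci_block N' (r1' + s') r3' (c1' + s') c3')))"
proof -
  interpret aci_matrix M m n by unfold_locales (rule assms(1))
  have card: "infinite (UNIV :: 'a set) \<or> n < card (UNIV :: 'a set)" using assms(2) by auto
  obtain V where V: "minimizer colset {..<n} V" "\<And>U. minimizer colset {..<n} U \<Longrightarrow> V \<subseteq> U"
    using least_minimizer[of "{..<n}" colset] by blast
  obtain W where W: "minimizer colset {..<n} W" "\<And>U. minimizer colset {..<n} U \<Longrightarrow> U \<subseteq> W"
    using greatest_minimizer[of "{..<n}" colset] by blast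
  have "constantRank M \<longleftrightarrow> (\<exists>R Q r1 c1 s r3 c3. normal_form M m n R Q r1 c1 s r3 c3)"
    using flag_form_with_extreme_minimizers[OF card _ V W] normal_form_imp_constantRank by blast
  moreover have "aci_equiv (aci_block (aci_mult R M Q) 0 r1 0 c1) (aci_block (aci_mult R' M Q') 0 r1' 0 c1') \<and>
      aci_equiv (aci_block (aci_mult R M Q) r1 s c1 s) (aci_block (aci_mult R' M Q') r1' s' c1' s') \<and>
      aci_equiv (aci_block (aci_mult R M Q) (r1 + s) r3 (c1 + s) c3)
        (aci_block (aci_mult R' M Q') (r1' + s') r3' (c1' + s') c3')"
    if nf: "normal_form M m n R Q r1 c1 s r3 c3" and nf': "normal_form M m n R' Q' r1' c1' s' r3' c3'"
      and max: "\<And>R Q r1 c1 t r3 c3. normal_form M m n R Q r1 c1 t r3 c3 \<Longrightarrow> t \<le> s"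
      and max': "\<And>R Q r1 c1 t r3 c3. normal_form M m n R Q r1 c1 t r3 c3 \<Longrightarrow> t \<le> s'"
    for R Q r1 c1 s r3 c3 R' Q' r1' c1' s' r3' c3'
  proof -
    obtain B p where R: "R \<in> carrier_mat m m" "B \<in> carrier_mat m m" "R * B = 1\<^sub>m m" "B * R = 1\<^sub>m m"
      and p: "p permutes {..<n}" and Q: "Q = perm_mat n p"
      and fl: "flag (map (col_fun m B) [0..<m]) r1 = V" "flag (map (col_fun m B) [0..<m]) (r1 + s) = W"
      and im: "p ` {..<c1} = {j \<in> {..<n}. colset j \<subseteq> V}" "p ` {..<c1 + s} = {j \<in> {..<n}. colset j \<subseteq> W}"
      and size: "r1 = fun_space.dim V" "r1 + s = fun_space.dim W"
        "c1 = card {j \<in> {..<n}. colset j \<subseteq> V}" "r1 + s + r3 = m" "c1 + s + c3 = n"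
      by (rule maximal_normal_form[OF card nf max V W]) blast+
    obtain B' p' where R': "R' \<in> carrier_mat m m" "B' \<in> carrier_mat m m" "R' * B' = 1\<^sub>m m" "B' * R' = 1\<^sub>m m"
      and p': "p' permutes {..<n}" and Q': "Q' = perm_mat n p'"
      and fl': "flag (map (col_fun m B') [0..<m]) r1' = V" "flag (map (col_fun m B') [0..<m]) (r1' + s') = W"
      and im': "p' ` {..<c1'} = {j \<in> {..<n}. colset j \<subseteq> V}" "p' ` {..<c1' + s'} = {j \<in> {..<n}. colset j \<subseteq> W}"
      and size': "r1' = fun_space.dim V" "r1' + s' = fun_space.dim W"
        "c1' = card {j \<in> {..<n}. colset j \<subseteq> V}" "r1' + s' + r3' = m" "c1' + s' + c3' = n"
      by (rule maximal_normal_form[OF card nf' max' V W]) blast+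
    \<comment> \<open>All block sizes are computed from \<open>V\<close>, \<open>W\<close>,
      \<open>m\<close> and \<open>n\<close>, which do not depend on the chosen form.\<close>
    have eqs: "r1' = r1" "s' = s" "c1' = c1" "r3' = r3" "c3' = c3" using size size' by linarith+
    note blocks = diagonal_blocks_equiv[OF R R' p p', folded Q Q']
    \<comment> \<open>At the lower edge of \<open>T\<close> both flags are the whole space.\<close>
    have flm: "flag (map (col_fun m C) [0..<m]) m = coord_space m"
      if "S \<in> carrier_mat m m" "C \<in> carrier_mat m m" "S * C = 1\<^sub>m m" "C * S = 1\<^sub>m m" for S C
      using span_dual_basis[OF dual_basis_inverse[OF that]] by simp
    have zero: "aci_entry_const (aci_mult R M Q) i j 0"
      if "i < m" "j < n" "(r1 \<le> i \<and> j < c1) \<or> (r1 + s \<le> i \<and> j < c1 + s)" for i j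
      using nf that unfolding normal_form_def block_form_def by blast
    \<comment> \<open>At the upper edge of \<open>W\<close> both flags are spans of the empty list
      and both column sets are empty, so only the edge at \<open>V\<close> carries
      information.\<close>
    have "aci_equiv (aci_block (aci_mult R M Q) 0 r1 0 c1) (aci_block (aci_mult R' M Q') 0 r1 0 c1)"
      using fl fl' im im' size zero unfolding eqs by (intro blocks) auto
    moreover have "aci_equiv (aci_block (aci_mult R M Q) r1 s c1 s) (aci_block (aci_mult R' M Q') r1 s c1 s)"
      using fl fl' im im' size zero unfolding eqs by (intro blocks) auto
    moreover have "aci_equiv (aci_block (aci_mult R M Q) (r1 + s) r3 (c1 + s) c3)
        (aci_block (aci_mult R' M Q') (r1 + s) r3 (c1 + s) c3)"
    proof (rule blocks)
      show "flag (map (col_fun m B) [0..<m]) (r1 + s + r3) = flag (map (col_fun m B') [0..<m]) (r1 + s + r3)"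
        using flm[OF R] flm[OF R'] size(4) by simp
      show "p ` {..<c1 + s + c3} = p' ` {..<c1 + s + c3}"
        using permutes_image[OF p] permutes_image[OF p'] size(5) by simp
    qed (use fl fl' im im' size zero eqs in auto)
    ultimately show ?thesis unfolding eqs by blast
  qed
  ultimately show ?thesis unfolding Let_def by blast
qed

end
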